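(* Let $a>0$ and $\omega>0$ be real numbers. Let $\mathbf{g}=D_\omega\circ R$ be a transformation of $\mathbb{R}^2$, where $R$ is the rotation about the origin by an angle $\varphi$ and $D_\omega$ is the dilation by $\omega$. Let $m=\min_{t\ge 0}J_0(t)=-0.4027593957\ldots$. Suppose that at least one of the following two conditions holds: (1) for all $t\ge 0$, $\; J_0(t)+J_0(\omega t)+m>-1$; (2) for all $t\ge 0$, $\; J_0(t)+J_0(\omega t)+J_0\bigl(t\sqrt{\omega^2-2\omega\cos\varphi+1}\bigr)>-1$. Then for any measurable coloring of the plane $\mathbb{R}^2$ into two colors there is a monochromatic triple $\{x,y,z\}$ such that $y=x+s$ and $z=x+\mathbf{g}(s)$ for some $s\in\mathcal{S}_a$.
   Context: $\mathcal{S}_a=\{x\in\mathbb{R}^2:\|x\|=a\}$ is the circle of radius $a$ centered at the origin, where $\|\cdot\|$ is the Euclidean norm. $D_\omega$ is the map $x\mapsto\omega x$. A measurable coloring of $\mathbb{R}^2$ into two colors is a partition of $\mathbb{R}^2$ into two disjoint Lebesgue measurable sets (the colors). A triple is monochromatic if all its points belong to the same color. $J_0$ is the zeroth Bessel function of the first kind, $J_0(z)=\sum_{k=0}^{\infty}\frac{(-1)^k (z/2)^{2k}}{(k!)^2}$. *)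

theory Defs
  imports "HOL-Analysis.Analysis"
begin

definition bessel_J0 :: "real \<Rightarrow> real" where
  "bessel_J0 z = (\<Sum>k. (-1) ^ k * (z / 2) ^ (2 * k) / (fact k)\<^sup>2)"

definition rotation :: "real \<Rightarrow> real ^ 2 \<Rightarrow> real ^ 2" where
  "rotation \<phi> x = vector [vector [cos \<phi>, - sin \<phi>], vector [sin \<phi>, cos \<phi>]] *v x"

definition dilation :: "real \<Rightarrow> real ^ 2 \<Rightarrow> real ^ 2" where
  "dilation \<omega> x = \<omega> *\<^sub>R x"

text \<open>A colour class may be empty.\<close>

definition measurable_two_coloring :: "(real ^ 2) set \<Rightarrow> (real ^ 2) set \<Rightarrow> bool" where
  "measurable_two_coloring A B \<longleftrightarrow>
     A \<in> sets lebesgue \<and> B \<in> sets lebesgue \<and> A \<inter> B = {} \<and> A \<union> B = UNIV"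

definition monochromatic :: "'a set \<Rightarrow> 'a set \<Rightarrow> 'a set \<Rightarrow> bool" where
  "monochromatic A B T \<longleftrightarrow> T \<subseteq> A \<or> T \<subseteq> B"

text \<open>
  The rest of this theory shows that the minimum of \<^const>\<open>bessel_J0\<close> on the nonnegative
  reals is attained, so that the \<open>LEAST\<close> operator denotes it.  With
  \<open>G u = (\<Sum>k. (-1)^k u^k / (k!)^2)\<close> we have \<open>J0 t = G (t^2/4)\<close> and
  \<open>u G'' + G' + G = 0\<close>, so the energy \<open>G^2 + u G'^2\<close> is nonincreasing.  Hence after
  a critical point \<open>v\<close> with \<open>G v \<le> 0\<close> the values of \<open>G\<close> are at least \<open>G v\<close>.
\<close>

definition bessel_coeff :: "nat \<Rightarrow> real" where
  "bessel_coeff k = (-1) ^ k / (fact k)\<^sup>2"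

definition bessel_G :: "real \<Rightarrow> real" where
  "bessel_G u = (\<Sum>k. bessel_coeff k * u ^ k)"

lemma bessel_J0_eq_G: "bessel_J0 t = bessel_G (t\<^sup>2 / 4)"
proof -
  have "(t / 2) ^ (2 * k) = (t\<^sup>2 / 4) ^ k" for k
    by (simp only: power_mult) (simp add: power_divide)
  then show ?thesis
    unfolding bessel_J0_def bessel_G_def bessel_coeff_def by simp
qed

lemma summable_bessel_coeff: "summable (\<lambda>k. bessel_coeff k * u ^ k)"
proof (rule summable_comparison_test')
  show "summable (\<lambda>k. \<bar>u\<bar> ^ k /\<^sub>R fact k)" by (rule summable_exp_generic)
  show "norm (bessel_coeff k * u ^ k) \<le> \<bar>u\<bar> ^ k /\<^sub>R fact k" if "k \<ge> 0" for k
  proof -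
    have "\<bar>u\<bar> ^ k * 1 \<le> \<bar>u\<bar> ^ k * (fact k :: real)"
      by (intro mult_left_mono fact_ge_1) auto
    then show ?thesis
      by (simp add: bessel_coeff_def abs_mult power_abs field_simps power2_eq_square)
  qed
qed

definition bessel_G1 :: "real \<Rightarrow> real" where
  "bessel_G1 u = (\<Sum>k. diffs bessel_coeff k * u ^ k)"

definition bessel_G2 :: "real \<Rightarrow> real" where
  "bessel_G2 u = (\<Sum>k. diffs (diffs bessel_coeff) k * u ^ k)"

lemma summable_bessel_diffs:
  "summable (\<lambda>k. diffs bessel_coeff k * u ^ k)"
  "summable (\<lambda>k. diffs (diffs bessel_coeff) k * u ^ k)"
  by (intro termdiff_converges_all summable_bessel_coeff)+

lemma DERIV_bessel_G: "DERIV bessel_G u :> bessel_G1 u"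
  unfolding bessel_G_def [abs_def] bessel_G1_def
  by (intro termdiffs_strong_converges_everywhere summable_bessel_coeff)

lemma DERIV_bessel_G1: "DERIV bessel_G1 u :> bessel_G2 u"
  unfolding bessel_G1_def [abs_def] bessel_G2_def
  by (intro termdiffs_strong_converges_everywhere summable_bessel_diffs)

lemma bessel_G_ode: "u * bessel_G2 u + bessel_G1 u + bessel_G u = 0"
proof -
  let ?d = "diffs bessel_coeff"
  have rec: "real (Suc k) * ?d k = - bessel_coeff k" for k
  proof -
    have "(fact (Suc k) :: real)\<^sup>2 = (real (Suc k))\<^sup>2 * (fact k)\<^sup>2"
      by (simp only: fact_Suc power_mult_distrib of_nat_Suc)
    then show ?thesis
      by (simp add: diffs_def bessel_coeff_def power2_eq_square del: of_nat_Suc fact_Suc)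
  qed
  have "(\<lambda>k. of_nat k * ?d k * u ^ (k - Suc 0)) sums bessel_G2 u"
    unfolding bessel_G2_def by (rule diffs_equiv) (rule summable_bessel_diffs)
  then have "(\<lambda>k. u * (of_nat k * ?d k * u ^ (k - Suc 0))) sums (u * bessel_G2 u)"
    by (rule sums_mult)
  moreover have "u * (of_nat k * ?d k * u ^ (k - Suc 0)) = of_nat k * ?d k * u ^ k" for k
    by (cases k) auto
  ultimately have "(\<lambda>k. of_nat k * ?d k * u ^ k) sums (u * bessel_G2 u)" by simp
  moreover have "(\<lambda>k. ?d k * u ^ k) sums bessel_G1 u"
    unfolding bessel_G1_def by (intro summable_sums summable_bessel_diffs)
  moreover have "(\<lambda>k. bessel_coeff k * u ^ k) sums bessel_G u"
    unfolding bessel_G_def by (intro summable_sums summable_bessel_coeff)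
  ultimately have "(\<lambda>k. of_nat k * ?d k * u ^ k + ?d k * u ^ k + bessel_coeff k * u ^ k)
      sums (u * bessel_G2 u + bessel_G1 u + bessel_G u)"
    by (intro sums_add)
  moreover have "of_nat k * ?d k * u ^ k + ?d k * u ^ k + bessel_coeff k * u ^ k = 0" for k
  proof -
    have "of_nat k * ?d k * u ^ k + ?d k * u ^ k + bessel_coeff k * u ^ k
        = (real (Suc k) * ?d k + bessel_coeff k) * u ^ k"
      by (simp add: algebra_simps)
    then show ?thesis using rec [of k] by simp
  qed
  ultimately have "(\<lambda>k. 0) sums (u * bessel_G2 u + bessel_G1 u + bessel_G u)" by simp
  then show ?thesis using sums_unique2 sums_zero by blast
qed

lemma bessel_G_energy_mono:
  assumes "0 \<le> v" "v \<le> u"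
  shows "(bessel_G u)\<^sup>2 + u * (bessel_G1 u)\<^sup>2 \<le> (bessel_G v)\<^sup>2 + v * (bessel_G1 v)\<^sup>2"
proof (rule DERIV_nonpos_imp_nonincreasing [OF \<open>v \<le> u\<close>,
      where f = "\<lambda>x. (bessel_G x)\<^sup>2 + x * (bessel_G1 x)\<^sup>2"])
  fix x :: real
  have "DERIV (\<lambda>x. (bessel_G x)\<^sup>2 + x * (bessel_G1 x)\<^sup>2) x :>
      2 * bessel_G x * bessel_G1 x + ((bessel_G1 x)\<^sup>2 + x * (2 * bessel_G1 x * bessel_G2 x))"
    by (auto intro!: derivative_eq_intros DERIV_bessel_G DERIV_bessel_G1)
  moreover have "2 * bessel_G x * bessel_G1 x + ((bessel_G1 x)\<^sup>2 + x * (2 * bessel_G1 x * bessel_G2 x))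
      = - (bessel_G1 x)\<^sup>2"
  proof -
    have "x * bessel_G2 x = - bessel_G1 x - bessel_G x" using bessel_G_ode [of x] by linarith
    moreover have "x * (2 * bessel_G1 x * bessel_G2 x) = 2 * bessel_G1 x * (x * bessel_G2 x)" by simp
    ultimately have "x * (2 * bessel_G1 x * bessel_G2 x) = 2 * bessel_G1 x * (- bessel_G1 x - bessel_G x)"
      by simp
    then show ?thesis by (simp add: algebra_simps power2_eq_square)
  qed
  ultimately show "\<exists>y. DERIV (\<lambda>x. (bessel_G x)\<^sup>2 + x * (bessel_G1 x)\<^sup>2) x :> y \<and> y \<le> 0"
    by (metis neg_le_0_iff_le zero_le_power2)
qed

lemma bessel_G_partial_sums:
  assumes "0 \<le> u" "u \<le> 9"
  shows "(\<Sum>k<8. bessel_coeff k * u ^ k) \<le> bessel_G u"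
    and "bessel_G u \<le> (\<Sum>k<5. bessel_coeff k * u ^ k)"
proof -
  let ?a = "\<lambda>k. u ^ (k + 2) / (fact (k + 2))\<^sup>2"
  have eq: "bessel_coeff (k + 2) * u ^ (k + 2) = (-1) ^ k * ?a k" for k
    by (simp add: bessel_coeff_def)
  have sm: "summable (\<lambda>k. (-1) ^ k * ?a k)"
    using summable_ignore_initial_segment [OF summable_bessel_coeff [of u], of 2] unfolding eq .
  have "(\<lambda>k. \<bar>(-1) ^ k * ?a k\<bar>) \<longlonglongrightarrow> 0"
    using tendsto_rabs [OF summable_LIMSEQ_zero [OF sm]] by simp
  then have lim: "?a \<longlonglongrightarrow> 0" using assms by (simp add: abs_mult)
  have pos: "0 \<le> ?a k" for k using assms by simp
  have dec: "?a (Suc k) \<le> ?a k" for k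
  proof -
    have "u \<le> (real (k + 3))\<^sup>2"
      using assms power_mono [of 3 "real (k + 3)" 2] by simp
    then have "u / (real (k + 3))\<^sup>2 \<le> 1" by simp
    moreover have "(fact (Suc k + 2) :: real) = real (k + 3) * fact (k + 2)"
      by (simp add: numeral_eq_Suc)
    then have "?a (Suc k) = u ^ (Suc k + 2) / (real (k + 3) * fact (k + 2))\<^sup>2"
      by (simp only:)
    then have "?a (Suc k) = ?a k * (u / (real (k + 3))\<^sup>2)"
      by (simp add: power_mult_distrib add.commute mult_ac del: fact_Suc)
    ultimately show ?thesis using pos [of k] mult_left_le by metis
  qed
  have split: "bessel_G u = (\<Sum>k. (-1) ^ k * ?a k) + (\<Sum>k<2. bessel_coeff k * u ^ k)"
    unfolding bessel_G_def
    using suminf_split_initial_segment [OF summable_bessel_coeff [of u], of 2] unfolding eq .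
  have shift: "(\<Sum>k<n + 2. bessel_coeff k * u ^ k)
      = (\<Sum>k<n. (-1) ^ k * ?a k) + (\<Sum>k<2. bessel_coeff k * u ^ k)" for n
  proof (induction n)
    case (Suc n)
    then show ?case using eq [of n] by (simp only: add_Suc sum.lessThan_Suc)
  qed (simp only: add_0 lessThan_0 sum.empty)
  show "(\<Sum>k<8. bessel_coeff k * u ^ k) \<le> bessel_G u"
    using summable_Leibniz'(2) [OF lim pos dec, of 3] shift [of 6] split by simp
  show "bessel_G u \<le> (\<Sum>k<5. bessel_coeff k * u ^ k)"
    using summable_Leibniz'(4) [OF lim pos dec, of 1] shift [of 3] split by simp
qed

lemma bessel_G_attains_min: "\<exists>v\<ge>0. \<forall>u\<ge>0. bessel_G v \<le> bessel_G u"
proof -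
  have G0: "bessel_G 0 = 1"
    using powser_zero [of bessel_coeff] by (simp add: bessel_G_def bessel_coeff_def)
  have G4: "bessel_G 4 < - (1/4)"
    using bessel_G_partial_sums(2) [of 4]
    by (simp add: bessel_coeff_def eval_nat_numeral fact_numeral)
  have G7: "- (1/4) < bessel_G 7"
    using bessel_G_partial_sums(1) [of 7]
    by (simp add: bessel_coeff_def eval_nat_numeral fact_numeral)
  have "continuous_on {0..7} bessel_G"
    using DERIV_bessel_G DERIV_continuous_on has_field_derivative_at_within by blast
  then obtain v where v: "v \<in> {0..7}" and min: "\<And>u. u \<in> {0..7} \<Longrightarrow> bessel_G v \<le> bessel_G u"
    using continuous_attains_inf [of "{0..7::real}" bessel_G] by auto
  have neg: "bessel_G v < - (1/4)" using min [of 4] G4 by simp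
  then have "v \<noteq> 0" "v \<noteq> 7" using G0 G7 by auto
  with v have v': "0 < v" "v < 7" by auto
  have crit: "bessel_G1 v = 0"
  proof (rule DERIV_local_min [OF DERIV_bessel_G])
    show "0 < Min {v, 7 - v}" using v' by simp
    show "\<forall>y. \<bar>v - y\<bar> < Min {v, 7 - v} \<longrightarrow> bessel_G v \<le> bessel_G y"
      by (auto intro!: min)
  qed
  have "bessel_G v \<le> bessel_G u" if "u \<ge> 0" for u
  proof (cases "u \<le> v")
    case True
    with that v' show ?thesis by (intro min) auto
  next
    case False
    then have "(bessel_G u)\<^sup>2 + u * (bessel_G1 u)\<^sup>2 \<le> (bessel_G v)\<^sup>2"
      using bessel_G_energy_mono [of v u] v' crit by simp
    moreover have "0 \<le> u * (bessel_G1 u)\<^sup>2" using that by simp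
    ultimately have "\<bar>bessel_G u\<bar> \<le> \<bar>bessel_G v\<bar>"
      by (simp add: abs_le_square_iff)
    with neg show ?thesis by linarith
  qed
  with v' show ?thesis by (intro exI [of _ v]) auto
qed

lemma bessel_J0_attains_min: "\<exists>t0\<ge>0. \<forall>t\<ge>0. bessel_J0 t0 \<le> bessel_J0 t"
proof -
  obtain v where v: "v \<ge> 0" "\<And>u. u \<ge> 0 \<Longrightarrow> bessel_G v \<le> bessel_G u"
    using bessel_G_attains_min by blast
  have "bessel_J0 (2 * sqrt v) = bessel_G v"
    using v by (simp add: bessel_J0_eq_G power_mult_distrib)
  with v show ?thesis
    by (intro exI [of _ "2 * sqrt v"]) (simp add: bessel_J0_eq_G)
qed

lemma bessel_J0_Least:
  defines "m \<equiv> (LEAST v. v \<in> bessel_J0 ` {0..})"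
  shows "m \<in> bessel_J0 ` {0..}" "t \<ge> 0 \<Longrightarrow> m \<le> bessel_J0 t"
proof -
  obtain t0 where t0: "t0 \<ge> 0" "\<And>t. t \<ge> 0 \<Longrightarrow> bessel_J0 t0 \<le> bessel_J0 t"
    using bessel_J0_attains_min by blast
  have "m = bessel_J0 t0"
    unfolding m_def by (rule Least_equality) (use t0 in auto)
  with t0 show "m \<in> bessel_J0 ` {0..}" "t \<ge> 0 \<Longrightarrow> m \<le> bessel_J0 t" by auto
qed

end

theory Submission
  imports Defs "HOL-Probability.Probability"
begin

text \<open>
The first condition implies the second, because \<open>m\<close> is a lower bound for the third summand.
Under the second condition, encode a two-colouring by a function \<open>f\<close> with values \<open>1\<close> and
\<open>- 1\<close>.  Three signs \<open>p\<close>, \<open>q\<close>, \<open>r\<close> that are not all equal satisfy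
\<open>p * q + p * r + q * r = - 1\<close>.  If no triple is monochromatic, then the autocorrelation \<open>K\<close> of
\<open>f\<close>, normalised by \<open>K 0 = 1\<close>, satisfies \<open>K s + K (g s) + K (g s - s) = - 1\<close> for all \<open>s\<close> on
the circle.  On the other hand \<open>K\<close> is, heuristically, a mean of cosines with nonnegative weights,
and the mean of \<open>cos (\<xi> \<bullet> v)\<close> over all rotations of \<open>v\<close> is \<open>J0 (norm \<xi> * norm v)\<close>.
Averaging the identity over the circle expresses \<open>- 1\<close> as a mean of the sums in the second
condition, with \<open>t = a * norm \<xi>\<close>; but these are all greater than \<open>- 1\<close>.

To make this precise, \<open>f\<close> is cut off outside a ball of large radius \<open>R\<close>, so that the identity
holds up to a boundary error of order \<open>R\<close> against a main term of order \<open>R\<^sup>2\<close>.  The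
condition is needed with a uniform margin \<open>\<delta>\<close> (\<open>bessel_J0_sum_bounded_away\<close>), which rests on the
decay of \<open>J0\<close> at infinity.  The cut-off function is replaced by a continuous one that agrees with
it off a set of small measure; this is where the measurability of the colouring is used.  For
bounded continuous integrable functions the positivity of averaged autocorrelations is
\<open>angular_mean_autocorrelation_nonneg\<close>.  There the autocorrelation is blurred by a Gaussian, which
is itself a mean of cosines, so that Fubini's theorem replaces Bochner's theorem.
\<close>

section \<open>Decay and angular averages of the Bessel function\<close>

lemma bessel_J0_0: "bessel_J0 0 = 1"
  using powser_zero [of bessel_coeff] by (simp add: bessel_J0_eq_G bessel_G_def bessel_coeff_def)

lemma continuous_on_bessel_J0: "continuous_on UNIV bessel_J0"
proof -
  have "continuous_on UNIV bessel_G"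
    using DERIV_bessel_G DERIV_continuous_on has_field_derivative_at_within by blast
  then have "continuous_on UNIV (\<lambda>t. bessel_G (t\<^sup>2 / 4))"
    by (rule continuous_on_compose2) (auto intro!: continuous_intros)
  then show ?thesis by (simp add: bessel_J0_eq_G [abs_def])
qed

lemma bessel_J0_meas [measurable]: "bessel_J0 \<in> borel_measurable borel"
  by (rule borel_measurable_continuous_onI [OF continuous_on_bessel_J0])

text \<open>
With \<open>u = t\<^sup>2 / 4\<close> and \<open>w t = sqrt t * J0 t\<close>, Bessel's equation becomes
\<open>w'' + (1 + 1 / (4 * t\<^sup>2)) * w = 0\<close>, so the energy \<open>w'\<^sup>2 + (1 + 1 / (4 * t\<^sup>2)) * w\<^sup>2\<close>
is nonincreasing and \<open>w\<close> stays bounded.  The function \<open>N\<close> of the proof is half this energy,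
written in the variable \<open>u\<close>.
\<close>
lemma bessel_G_squared_le:
  obtains C where "\<And>u. u \<ge> 1 \<Longrightarrow> (bessel_G u)\<^sup>2 \<le> C / sqrt u"
proof -
  define N where "N u = sqrt u * ((bessel_G u)\<^sup>2 + u * (bessel_G1 u)\<^sup>2
     + bessel_G u * bessel_G1 u / 2 + (bessel_G u)\<^sup>2 / (8 * u))" for u
  have mono: "N u \<le> N 1" if "u \<ge> 1" for u
  proof (rule DERIV_nonpos_imp_nonincreasing [OF that])
    fix x :: real
    assume "1 \<le> x" "x \<le> u"
    then have x: "x > 0" by simp
    define y where "y = sqrt x"
    have y: "y > 0" "x = y * y" "y\<^sup>2 = x" using x by (auto simp: y_def)
    have ode: "bessel_G2 x = - (bessel_G1 x + bessel_G x) / x"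
      using bessel_G_ode [of x] x by (simp add: field_simps) 
    have "DERIV N x :> - (bessel_G x)\<^sup>2 / (16 * x * sqrt x)"
      unfolding N_def [abs_def]
      apply (rule derivative_eq_intros DERIV_bessel_G DERIV_bessel_G1 refl | use x in simp; fail)+
      apply (simp only: ode y_def [symmetric])
      \<comment> \<open>In terms of \<open>y = sqrt x\<close> the identity is one between rational functions.\<close>
      using y(1) unfolding y(2)
      apply (simp add: field_simps power2_eq_square)
      done
    moreover have "- (bessel_G x)\<^sup>2 / (16 * x * sqrt x) \<le> 0" using x by simp
    ultimately show "\<exists>y. DERIV N x :> y \<and> y \<le> 0" by blast
  qed
  have "(bessel_G u)\<^sup>2 \<le> N 1 / sqrt u" if "u \<ge> 1" for u
  proof -
    \<comment> \<open>Completing the square shows that \<open>N\<close> controls the square of \<open>bessel_G\<close>.\<close>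
    have "N u = sqrt u * ((bessel_G u)\<^sup>2 + u * (bessel_G1 u + bessel_G u / (4 * u))\<^sup>2
        + (bessel_G u)\<^sup>2 / (16 * u))"
      using that by (simp add: N_def field_simps power2_eq_square)
    also have "\<dots> \<ge> sqrt u * (bessel_G u)\<^sup>2"
      using that by (intro mult_left_mono) auto
    finally show ?thesis using mono [OF that] that by (simp add: field_simps)
  qed
  then show ?thesis by (rule that)
qed

lemma bessel_J0_tendsto_0: "(bessel_J0 \<longlongrightarrow> 0) at_top"
proof -
  obtain C where C: "\<And>u. u \<ge> 1 \<Longrightarrow> (bessel_G u)\<^sup>2 \<le> C / sqrt u"
    by (rule bessel_G_squared_le) auto
  have le: "(bessel_J0 t)\<^sup>2 \<le> 2 * C / t" if "t \<ge> 2" for t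
  proof -
    have "(bessel_J0 t)\<^sup>2 \<le> C / sqrt (t\<^sup>2 / 4)"
      unfolding bessel_J0_eq_G using that power_mono [of 2 t 2] by (intro C) auto
    then show ?thesis using that by (simp add: real_sqrt_divide mult.commute)
  qed
  have "((\<lambda>t. (bessel_J0 t)\<^sup>2) \<longlongrightarrow> 0) at_top"
  proof (rule tendsto_sandwich [where f = "\<lambda>_. 0" and h = "\<lambda>t. 2 * C / t"])
    show "\<forall>\<^sub>F t in at_top. (bessel_J0 t)\<^sup>2 \<le> 2 * C / t"
      using eventually_ge_at_top [of 2] by eventually_elim (rule le)
    show "((\<lambda>t. 2 * C / t) \<longlongrightarrow> 0) at_top"
      by (intro tendsto_divide_0 [OF tendsto_const] filterlim_at_top_imp_at_infinity filterlim_ident)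
  qed auto
  from tendsto_real_sqrt [OF this] show ?thesis by (simp add: tendsto_rabs_zero_iff)
qed

text \<open>
The strict inequality has a uniform margin: since \<open>J0\<close> tends to 0, the sum is eventually at least
\<open>- 1 / 2\<close>, and on the remaining compact interval it attains its infimum.  If \<open>c = 0\<close>, which in
the application means that \<open>g\<close> is the identity, the third summand is the constant 1.
\<close>
lemma bessel_J0_sum_bounded_away:
  assumes "\<omega> > 0" "c \<ge> 0"
    and gt: "\<And>t. t \<ge> 0 \<Longrightarrow> bessel_J0 t + bessel_J0 (\<omega> * t) + bessel_J0 (t * c) > - 1"
  obtains \<delta> where "0 < \<delta>" "\<delta> \<le> 1"
    "\<And>t. t \<ge> 0 \<Longrightarrow> bessel_J0 t + bessel_J0 (\<omega> * t) + bessel_J0 (t * c) \<ge> - 1 + \<delta>"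
proof -
  define \<Phi> where "\<Phi> t = bessel_J0 t + bessel_J0 (\<omega> * t) + bessel_J0 (t * c)" for t
  have ev: "\<forall>\<^sub>F t in at_top. bessel_J0 (t * k) > - 1 / 6" if "k > 0" for k
  proof -
    have "filterlim (\<lambda>t. t * k) at_top at_top"
      using that by (intro filterlim_at_top_mult_tendsto_pos [OF tendsto_const _ filterlim_ident]) auto
    then have "((\<lambda>t. bessel_J0 (t * k)) \<longlongrightarrow> 0) at_top"
      by (rule filterlim_compose [OF bessel_J0_tendsto_0])
    then show ?thesis by (rule order_tendstoD) simp
  qed
  have "\<forall>\<^sub>F t in at_top. bessel_J0 (t * c) > - 1 / 6"
    using ev [of c] \<open>c \<ge> 0\<close> by (cases "c = 0") (auto simp: bessel_J0_0)
  with ev [OF zero_less_one] ev [OF \<open>\<omega> > 0\<close>] have "\<forall>\<^sub>F t in at_top. \<Phi> t \<ge> - 1 / 2"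
    by eventually_elim (simp add: \<Phi>_def mult.commute)
  then obtain T where T: "\<And>t. t \<ge> T \<Longrightarrow> \<Phi> t \<ge> - 1 / 2"
    by (auto simp: eventually_at_top_linorder)
  have "continuous_on {0..max T 0} \<Phi>"
    unfolding \<Phi>_def
    by (intro continuous_intros continuous_on_compose2 [OF continuous_on_bessel_J0]) auto
  then obtain t0 where t0: "t0 \<in> {0..max T 0}" "\<And>t. t \<in> {0..max T 0} \<Longrightarrow> \<Phi> t0 \<le> \<Phi> t"
    using continuous_attains_inf [of "{0..max T 0}" \<Phi>] by auto
  show ?thesis
  proof (rule that [of "min (1 / 2) (\<Phi> t0 + 1)"])
    show "0 < min (1 / 2) (\<Phi> t0 + 1)" using gt [of t0] t0(1) by (simp add: \<Phi>_def)
    fix t :: real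
    assume "t \<ge> 0"
    then have "\<Phi> t \<ge> - 1 / 2 \<or> \<Phi> t \<ge> \<Phi> t0" using T [of t] t0(2) [of t] by force
    then show "bessel_J0 t + bessel_J0 (\<omega> * t) + bessel_J0 (t * c) \<ge> - 1 + min (1 / 2) (\<Phi> t0 + 1)"
      by (auto simp: \<Phi>_def [symmetric])
  qed simp
qed

text \<open>
With \<open>X = A * cos \<theta> + B * sin \<theta>\<close> and \<open>Y = X'\<close>, one has \<open>X'' = - X\<close> and
\<open>X\<^sup>2 + Y\<^sup>2 = A\<^sup>2 + B\<^sup>2\<close>.  Integrating the derivative of \<open>X ^ (n + 1) * Y\<close> over a period
therefore yields the Wallis recursion that links the powers \<open>n\<close> and \<open>n + 2\<close>.
\<close>
lemma trig_power_has_integral: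
  fixes A B :: real
  shows "((\<lambda>\<theta>. (A * cos \<theta> + B * sin \<theta>) ^ (2 * k)) has_integral
    2 * pi * fact (2 * k) * ((A\<^sup>2 + B\<^sup>2) / 4) ^ k / (fact k)\<^sup>2) {0..2 * pi}"
proof (induction k)
  case 0
  show ?case using has_integral_const_real [of "1::real" 0 "2 * pi"] by simp
next
  case (Suc k)
  define X Y where "X \<theta> = A * cos \<theta> + B * sin \<theta>" and "Y \<theta> = B * cos \<theta> - A * sin \<theta>" for \<theta> :: real
  define n where "n = 2 * k"
  have XY: "(X \<theta>)\<^sup>2 + (Y \<theta>)\<^sup>2 = A\<^sup>2 + B\<^sup>2" for \<theta>
  proof -
    have "(X \<theta>)\<^sup>2 + (Y \<theta>)\<^sup>2 = (A\<^sup>2 + B\<^sup>2) * ((sin \<theta>)\<^sup>2 + (cos \<theta>)\<^sup>2)"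
      unfolding X_def Y_def by algebra
    then show ?thesis by simp
  qed
  have dX: "DERIV X \<theta> :> Y \<theta>" and dY: "DERIV Y \<theta> :> - X \<theta>" for \<theta>
    unfolding X_def [abs_def] Y_def [abs_def]
    by (auto intro!: derivative_eq_intros simp: algebra_simps)
  have d: "DERIV (\<lambda>\<theta>. X \<theta> ^ (n + 1) * Y \<theta>) \<theta> :>
      (n + 1) * (A\<^sup>2 + B\<^sup>2) * X \<theta> ^ n - (n + 2) * X \<theta> ^ (n + 2)" for \<theta>
  proof -
    have "DERIV (\<lambda>\<theta>. X \<theta> ^ (n + 1) * Y \<theta>) \<theta> :>
      (n + 1) * X \<theta> ^ n * (Y \<theta>)\<^sup>2 - X \<theta> ^ (n + 2)"
      by (rule derivative_eq_intros dX dY refl)+ (simp add: power2_eq_square algebra_simps)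
    moreover have "(Y \<theta>)\<^sup>2 = A\<^sup>2 + B\<^sup>2 - (X \<theta>)\<^sup>2" using XY [of \<theta>] by simp
    moreover have "(n + 1) * X \<theta> ^ n * (A\<^sup>2 + B\<^sup>2 - (X \<theta>)\<^sup>2) - X \<theta> ^ (n + 2) =
        (n + 1) * (A\<^sup>2 + B\<^sup>2) * X \<theta> ^ n - (n + 2) * X \<theta> ^ (n + 2)"
      by (simp add: algebra_simps power2_eq_square)
    ultimately show ?thesis by (simp only:)
  qed
  have "((\<lambda>\<theta>. (n + 1) * (A\<^sup>2 + B\<^sup>2) * X \<theta> ^ n - (n + 2) * X \<theta> ^ (n + 2)) has_integral
      (X (2 * pi) ^ (n + 1) * Y (2 * pi) - X 0 ^ (n + 1) * Y 0)) {0..2 * pi}"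
    using d by (intro fundamental_theorem_of_calculus)
      (auto simp: has_real_derivative_iff_has_vector_derivative [symmetric]
        intro: has_field_derivative_at_within)
  then have 1: "((\<lambda>\<theta>. (n + 1) * (A\<^sup>2 + B\<^sup>2) * X \<theta> ^ n - (n + 2) * X \<theta> ^ (n + 2)) has_integral 0) {0..2 * pi}"
    by (simp add: X_def Y_def)
  define I where "I = 2 * pi * fact (2 * k) * ((A\<^sup>2 + B\<^sup>2) / 4) ^ k / (fact k)\<^sup>2"
  have "((\<lambda>\<theta>. (n + 1) * (A\<^sup>2 + B\<^sup>2) * X \<theta> ^ n) has_integral (n + 1) * (A\<^sup>2 + B\<^sup>2) * I) {0..2 * pi}"
    using Suc.IH by (intro has_integral_mult_right) (simp add: X_def n_def I_def)
  from has_integral_diff [OF this 1]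
  have "((\<lambda>\<theta>. (n + 2) * X \<theta> ^ (n + 2)) has_integral (n + 1) * (A\<^sup>2 + B\<^sup>2) * I) {0..2 * pi}"
    by simp
  from has_integral_divide [OF this, of "n + 2"]
  have "((\<lambda>\<theta>. X \<theta> ^ (n + 2)) has_integral (n + 1) * (A\<^sup>2 + B\<^sup>2) * I / (n + 2)) {0..2 * pi}"
    by simp
  moreover have "(n + 1) * (A\<^sup>2 + B\<^sup>2) * I / (n + 2) =
      2 * pi * fact (2 * Suc k) * ((A\<^sup>2 + B\<^sup>2) / 4) ^ Suc k / (fact (Suc k))\<^sup>2"
  proof -
    define r where "r = real k + 1"
    have "(fact (2 * Suc k) :: real) = (2 * r) * (2 * r - 1) * fact (2 * k)"
      and "(fact (Suc k) :: real) = r * fact k"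
      and "real (n + 1) = 2 * r - 1" "real (n + 2) = 2 * r" and "r > 0"
      by (auto simp: n_def r_def algebra_simps)
    then show ?thesis
      unfolding I_def by (simp add: divide_simps power2_eq_square del: fact_Suc of_nat_add)
  qed
  ultimately show ?case by (simp add: X_def n_def)
qed

definition uniform_angle :: "real measure" where
  "uniform_angle = uniform_measure lborel {0..2 * pi}"

lemma sets_uniform_angle [measurable_cong, simp]: "sets uniform_angle = sets borel"
  by (simp add: uniform_angle_def)

lemma prob_space_uniform_angle: "prob_space uniform_angle"
  unfolding uniform_angle_def by (rule prob_space_uniform_measure) auto

lemma integral_uniform_angle:
  fixes f :: "real \<Rightarrow> real"
  assumes "continuous_on {0..2 * pi} f" "f \<in> borel_measurable borel" "(f has_integral I) {0..2 * pi}"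
  shows "(LINT \<theta>|uniform_angle. f \<theta>) = I / (2 * pi)"
proof -
  have "set_integrable lborel {0..2 * pi} f"
    using assms(1) by (rule borel_integrable_atLeastAtMost')
  note 1 = set_borel_integral_eq_integral(2) [OF this]
  have 2: "uniform_angle = density lborel (\<lambda>\<theta>. ennreal (indicator {0..2 * pi} \<theta> / (2 * pi)))"
    unfolding uniform_angle_def uniform_measure_def
    by (intro arg_cong [where f = "density lborel"] ext)
      (auto simp: indicator_def divide_ennreal [symmetric] ennreal_1)
  have "(LINT \<theta>|uniform_angle. f \<theta>) = (LINT \<theta>|lborel. indicator {0..2 * pi} \<theta> * f \<theta>) / (2 * pi)"
    unfolding 2 using assms(2) by (subst integral_density) auto
  then show ?thesis
    using 1 integral_unique [OF assms(3)] by (simp add: set_lebesgue_integral_def)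
qed

text \<open>
Bessel's integral, by termwise integration of the cosine series.
\<close>
theorem bessel_J0_angular_mean:
  "(LINT \<theta>|uniform_angle. cos (A * cos \<theta> + B * sin \<theta>)) = bessel_J0 (sqrt (A\<^sup>2 + B\<^sup>2))"
proof -
  interpret prob_space uniform_angle by (rule prob_space_uniform_angle)
  define X where "X \<theta> = A * cos \<theta> + B * sin \<theta>" for \<theta> :: real
  define q where "q = (A\<^sup>2 + B\<^sup>2) / 4"
  define f where "f k \<theta> = (- 1) ^ k * X \<theta> ^ (2 * k) / fact (2 * k)" for k \<theta>
  have X: "\<bar>X \<theta>\<bar> \<le> \<bar>A\<bar> + \<bar>B\<bar>" for \<theta>
  proof -
    have "\<bar>X \<theta>\<bar> \<le> \<bar>A\<bar> * \<bar>cos \<theta>\<bar> + \<bar>B\<bar> * \<bar>sin \<theta>\<bar>"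
      unfolding X_def by (metis abs_mult abs_triangle_ineq)
    also have "\<dots> \<le> \<bar>A\<bar> * 1 + \<bar>B\<bar> * 1"
      by (intro add_mono mult_left_mono) auto
    finally show ?thesis by simp
  qed
  have f_meas [measurable]: "f k \<in> borel_measurable borel" for k
    unfolding f_def [abs_def] X_def by measurable
  have b: "\<bar>f k \<theta>\<bar> \<le> (\<bar>A\<bar> + \<bar>B\<bar>) ^ (2 * k) / fact (2 * k)" for k \<theta>
    using power_mono [OF X abs_ge_zero, of \<theta> "2 * k"]
    by (simp add: f_def abs_mult power_abs divide_right_mono)
  have s2: "summable (\<lambda>k. (\<bar>A\<bar> + \<bar>B\<bar>) ^ (2 * k) / fact (2 * k))"
  proof (rule summable_comparison_test' [where N = 0])
    show "summable (\<lambda>k. ((\<bar>A\<bar> + \<bar>B\<bar>)\<^sup>2) ^ k /\<^sub>R fact k)" by (rule summable_exp_generic)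
    show "norm ((\<bar>A\<bar> + \<bar>B\<bar>) ^ (2 * k) / fact (2 * k)) \<le> ((\<bar>A\<bar> + \<bar>B\<bar>)\<^sup>2) ^ k /\<^sub>R fact k" for k
    proof -
      have "(fact k :: real) \<le> fact (2 * k)" by (rule fact_mono) simp
      then have "(\<bar>A\<bar> + \<bar>B\<bar>) ^ (2 * k) / fact (2 * k) \<le> (\<bar>A\<bar> + \<bar>B\<bar>) ^ (2 * k) / fact k"
        by (intro divide_left_mono) auto
      then show ?thesis by (simp only: power_mult) (simp add: field_simps)
    qed
  qed
  have int: "integrable uniform_angle (f k)" for k
    using b by (intro integrable_const_bound [where B = "(\<bar>A\<bar> + \<bar>B\<bar>) ^ (2 * k) / fact (2 * k)"]) auto
  have fs: "(\<lambda>k. f k \<theta>) sums cos (X \<theta>)" for \<theta>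
    using cos_paired [of "X \<theta>"] by (simp add: f_def)
  have fi: "(LINT \<theta>|uniform_angle. f k \<theta>) = (- 1) ^ k * q ^ k / (fact k)\<^sup>2" for k
  proof -
    have "((\<lambda>\<theta>. (- 1) ^ k / fact (2 * k) * X \<theta> ^ (2 * k)) has_integral
        (- 1) ^ k / fact (2 * k) * (2 * pi * fact (2 * k) * q ^ k / (fact k)\<^sup>2)) {0..2 * pi}"
      unfolding X_def q_def by (intro has_integral_mult_right trig_power_has_integral)
    then have "(f k has_integral (- 1) ^ k / fact (2 * k) * (2 * pi * fact (2 * k) * q ^ k / (fact k)\<^sup>2)) {0..2 * pi}"
      by (simp add: f_def [abs_def])
    from integral_uniform_angle [OF _ _ this] show ?thesis
      by (simp add: f_def X_def continuous_intros)
  qed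
  have "(LINT \<theta>|uniform_angle. (\<Sum>k. f k \<theta>)) = (\<Sum>k. (LINT \<theta>|uniform_angle. f k \<theta>))"
  proof (rule integral_suminf [OF int])
    show "AE \<theta> in uniform_angle. summable (\<lambda>k. norm (f k \<theta>))"
      using b by (intro AE_I2 summable_comparison_test' [OF s2, of 0]) simp
    show "summable (\<lambda>k. LINT \<theta>|uniform_angle. norm (f k \<theta>))"
    proof (rule summable_comparison_test' [OF s2, of 0])
      show "norm (LINT \<theta>|uniform_angle. norm (f k \<theta>)) \<le> (\<bar>A\<bar> + \<bar>B\<bar>) ^ (2 * k) / fact (2 * k)" for k
        using b [of k] int [of k] by (auto intro!: integral_le_const)
    qed
  qed
  moreover have "(\<Sum>k. f k \<theta>) = cos (X \<theta>)" for \<theta>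
    using fs by (rule sums_unique [symmetric])
  moreover have "(sqrt (A\<^sup>2 + B\<^sup>2) / 2) ^ (2 * k) = q ^ k" for k
    by (simp only: power_mult) (simp add: power_divide q_def)
  ultimately show ?thesis by (simp add: fi X_def bessel_J0_def)
qed

lemma abs_bessel_J0_le: "\<bar>bessel_J0 t\<bar> \<le> 1"
proof -
  interpret prob_space uniform_angle by (rule prob_space_uniform_angle)
  have "bessel_J0 t = bessel_J0 (sqrt (t\<^sup>2 + 0\<^sup>2))"
    by (simp add: bessel_J0_eq_G)
  also have "\<dots> = (LINT \<theta>|uniform_angle. cos (t * cos \<theta>))"
    using bessel_J0_angular_mean [of t 0] by simp
  finally have "bessel_J0 t = (LINT \<theta>|uniform_angle. cos (t * cos \<theta>))" .
  moreover have "\<bar>LINT \<theta>|uniform_angle. cos (t * cos \<theta>)\<bar> \<le> (LINT \<theta>|uniform_angle. \<bar>cos (t * cos \<theta>)\<bar>)"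
    by (rule integral_abs_bound)
  moreover have "\<dots> \<le> 1"
    by (intro integral_le_const integrable_const_bound [where B = 1]) auto
  ultimately show ?thesis by linarith
qed

section \<open>Rotations of the plane\<close>

lemma rotation_eq: "rotation \<theta> v = cos \<theta> *\<^sub>R v + sin \<theta> *\<^sub>R vector [- v $ 2, v $ 1]"
  by (simp add: rotation_def vec_eq_iff forall_2 matrix_vector_mult_def sum_2)

lemma norm_rotation: "norm (rotation \<theta> v) = norm v"
proof -
  have "(norm (rotation \<theta> v))\<^sup>2 = ((sin \<theta>)\<^sup>2 + (cos \<theta>)\<^sup>2) * (norm v)\<^sup>2"
    unfolding power2_norm_eq_inner
    by (simp add: rotation_eq inner_vec_def sum_2 power2_eq_square algebra_simps del: sin_cos_squared_add3)
  then show ?thesis by simp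
qed

lemma rotation_scaleR: "rotation \<theta> (c *\<^sub>R v) = c *\<^sub>R rotation \<theta> v"
  by (simp add: rotation_def matrix_vector_mult_scaleR)

lemma rotation_diff: "rotation \<theta> (u - v) = rotation \<theta> u - rotation \<theta> v"
  by (simp add: rotation_def matrix_vector_mult_diff_distrib)

lemma rotation_commute: "rotation \<theta> (rotation \<phi> v) = rotation \<phi> (rotation \<theta> v)"
  by (simp add: rotation_eq vec_eq_iff forall_2 algebra_simps)

lemma continuous_rotation: "continuous_on UNIV (\<lambda>\<theta>. rotation \<theta> v)"
  unfolding rotation_eq by (intro continuous_intros)

lemma rotation_meas [measurable]: "(\<lambda>\<theta>. rotation \<theta> v) \<in> borel_measurable borel"
  by (rule borel_measurable_continuous_onI [OF continuous_rotation])

lemma bessel_J0_rotation_mean: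
  "(LINT \<theta>|uniform_angle. cos (u \<bullet> rotation \<theta> v)) = bessel_J0 (norm u * norm v)"
proof -
  define v' :: "real ^ 2" where "v' = vector [- v $ 2, v $ 1]"
  have "(u \<bullet> v)\<^sup>2 + (u \<bullet> v')\<^sup>2 = (norm u * norm v)\<^sup>2"
    unfolding power_mult_distrib power2_norm_eq_inner
    by (simp add: v'_def inner_vec_def sum_2 power2_eq_square algebra_simps)
  then have "bessel_J0 (norm u * norm v) = bessel_J0 (sqrt ((u \<bullet> v)\<^sup>2 + (u \<bullet> v')\<^sup>2))" by simp
  also have "\<dots> = (LINT \<theta>|uniform_angle. cos ((u \<bullet> v) * cos \<theta> + (u \<bullet> v') * sin \<theta>))"
    by (rule bessel_J0_angular_mean [symmetric])
  finally show ?thesis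
    by (simp add: rotation_eq inner_add_right v'_def mult.commute)
qed

section \<open>Gaussian integrals\<close>

lemma integrable_exp_minus_square:
  "integrable lborel (\<lambda>x :: 'a :: euclidean_space. exp (- (norm x)\<^sup>2 / 2))"
proof -
  have fin: "(\<integral>\<^sup>+ t. ennreal (exp (- t\<^sup>2 / 2)) \<partial>lborel) < \<infinity>"
  proof -
    have "integrable lborel (\<lambda>t. std_normal_density t * sqrt (2 * pi))"
      by (intro integrable_mult_left) simp
    then have "integrable lborel (\<lambda>t::real. exp (- t\<^sup>2 / 2))"
      by (simp add: std_normal_density_def)
    then show ?thesis by (simp add: integrable_iff_bounded)
  qed
  have "exp (- (norm x)\<^sup>2 / 2) = (\<Prod>b\<in>Basis. exp (- (x \<bullet> b)\<^sup>2 / 2))" for x :: 'a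
    by (subst power2_norm_eq_inner, subst euclidean_inner)
      (simp add: exp_sum [symmetric] sum_negf sum_divide_distrib power2_eq_square)
  then have "(\<integral>\<^sup>+ x. ennreal (exp (- (norm x)\<^sup>2 / 2)) \<partial>(lborel :: 'a measure))
      = (\<integral>\<^sup>+ x. (\<Prod>b\<in>Basis. ennreal (exp (- (x \<bullet> b)\<^sup>2 / 2))) \<partial>(lborel :: 'a measure))"
    by (simp add: prod_ennreal)
  also have "\<dots> = (\<Prod>b\<in>(Basis :: 'a set). (\<integral>\<^sup>+ t. ennreal (exp (- t\<^sup>2 / 2)) \<partial>lborel))"
    by (rule nn_integral_lborel_prod) auto
  also have "\<dots> < \<infinity>" using fin by (simp add: power_less_top_ennreal)
  finally show ?thesis by (simp add: integrable_iff_bounded)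
qed

lemma lborel_shift:
  fixes f :: "'a :: euclidean_space \<Rightarrow> real"
  shows lborel_integral_shift: "f \<in> borel_measurable borel \<Longrightarrow> (LINT x|lborel. f (x + t)) = (LINT x|lborel. f x)"
    and lborel_integrable_shift: "integrable lborel f \<Longrightarrow> integrable lborel (\<lambda>x. f (x + t))"
proof -
  show "(LINT x|lborel. f (x + t)) = (LINT x|lborel. f x)" if [measurable]: "f \<in> borel_measurable borel"
  proof -
    have "(LINT x|lborel. f x) = (LINT x|distr lborel borel ((+) t). f x)"
      by (simp add: lborel_distr_plus)
    also have "\<dots> = (LINT x|lborel. f (t + x))" by (rule integral_distr) auto
    finally show ?thesis by (simp add: add.commute)
  qed
  show "integrable lborel (\<lambda>x. f (x + t))" if "integrable lborel f"
  proof -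
    have "integrable (distr lborel borel ((+) t)) f" using that by (simp add: lborel_distr_plus)
    then have "integrable lborel (\<lambda>x. f (t + x))"
      using borel_measurable_integrable [OF that] by (subst (asm) integrable_distr_eq) auto
    then show ?thesis by (simp add: add.commute)
  qed
qed

lemma lborel_integral_scale:
  fixes f :: "'a :: euclidean_space \<Rightarrow> real"
  assumes [measurable]: "f \<in> borel_measurable borel" and c: "c > 0"
  shows "(LINT x|lborel. f x) = c ^ DIM('a) * (LINT x|lborel. f (t + c *\<^sub>R x))"
proof -
  have "(LINT x|lborel. f x) =
      (LINT x|density (distr lborel borel (\<lambda>x. t + c *\<^sub>R x)) (\<lambda>_. ennreal (\<bar>c\<bar> ^ DIM('a))). f x)"
    using lborel_affine [of c t] c by simp
  also have "\<dots> = c ^ DIM('a) * (LINT x|lborel. f (t + c *\<^sub>R x))"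
    using c by (simp add: integral_density integral_distr)
  finally show ?thesis .
qed

abbreviation std_normal_pair :: "(real \<times> real) measure" where
  "std_normal_pair \<equiv> std_normal_distribution \<Otimes>\<^sub>M std_normal_distribution"

definition vec_of_pair :: "real \<times> real \<Rightarrow> real ^ 2" where
  "vec_of_pair p = vector [fst p, snd p]"

lemma inner_vec_of_pair: "vec_of_pair p \<bullet> u = fst p * u $ 1 + snd p * u $ 2"
  by (simp add: vec_of_pair_def inner_vec_def sum_2)

lemma continuous_vec_of_pair: "continuous_on UNIV vec_of_pair"
proof (subst continuous_on_componentwise, intro ballI)
  fix b :: "real ^ 2"
  show "continuous_on UNIV (\<lambda>p. vec_of_pair p \<bullet> b)"
    unfolding inner_vec_of_pair by (intro continuous_intros)
qed

lemma measurable_vec_of_pair [measurable]: "vec_of_pair \<in> borel_measurable borel"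
  by (rule borel_measurable_continuous_onI [OF continuous_vec_of_pair])

lemma sets_std_normal_pair [measurable_cong]: "sets std_normal_pair = sets borel"
  by (simp add: borel_prod [symmetric] cong: sets_pair_measure_cong)

lemma prob_space_std_normal_pair: "prob_space std_normal_pair"
proof -
  interpret prob_space std_normal_distribution by (rule prob_space_normal_density) simp
  interpret pair_prob_space std_normal_distribution std_normal_distribution ..
  show ?thesis by unfold_locales
qed

text \<open>
The Gaussian is its own Fourier transform.  Representing it as a mean of cosines over random
frequencies replaces Fourier inversion in everything below.
\<close>
lemma gaussian_as_cosine_mean:
  "(LINT p|std_normal_pair. cos (vec_of_pair p \<bullet> u)) = exp (- (norm u)\<^sup>2 / 2)"
proof -
  interpret N: prob_space std_normal_distribution by (rule prob_space_normal_density) simp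
  interpret pair_prob_space std_normal_distribution std_normal_distribution ..
  define C S where "C t = (LINT x|std_normal_distribution. cos (t * x))"
    and "S t = (LINT x|std_normal_distribution. sin (t * x))" for t
  have int: "integrable std_normal_distribution (\<lambda>x. iexp (t * x))" for t
    by (rule N.integrable_const_bound [where B = 1]) auto
  have ch: "char std_normal_distribution t = exp (- t\<^sup>2 / 2)" for t
    by (simp add: char_std_normal_distribution)
  have C: "C t = exp (- t\<^sup>2 / 2)" for t
  proof -
    have "C t = Re (char std_normal_distribution t)"
      unfolding C_def char_def by (subst integral_Re [OF int, symmetric]) (simp add: Re_exp)
    then show ?thesis unfolding ch by simp
  qed
  have S: "S t = 0" for t
  proof -
    have "S t = Im (char std_normal_distribution t)"
      unfolding S_def char_def by (subst integral_Im [OF int, symmetric]) (simp add: Im_exp)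
    then show ?thesis unfolding ch by simp
  qed
  have ic: "integrable std_normal_distribution (\<lambda>x. cos (t * x))" 
    and si: "integrable std_normal_distribution (\<lambda>x. sin (t * x))" for t
    by (rule N.integrable_const_bound [where B = 1]; auto)+
  have "(LINT p|std_normal_pair. cos (vec_of_pair p \<bullet> u))
      = (LINT x|std_normal_distribution. (LINT y|std_normal_distribution. cos (u $ 1 * x + u $ 2 * y)))"
  proof (subst integral_fst' [symmetric])
    have "(\<lambda>p. cos (vec_of_pair p \<bullet> u)) \<in> borel_measurable std_normal_pair" by measurable
    then show "integrable std_normal_pair (\<lambda>p. cos (vec_of_pair p \<bullet> u))"
      by (intro integrable_const_bound [where B = 1]) auto
  qed (simp add: inner_vec_of_pair mult.commute)
  also have "\<dots> = (LINT x|std_normal_distribution. cos (u $ 1 * x) * C (u $ 2) - sin (u $ 1 * x) * S (u $ 2))"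
    by (simp add: cos_add C_def S_def Bochner_Integration.integral_diff ic si)
  also have "\<dots> = C (u $ 1) * C (u $ 2)"
    unfolding S by (simp add: C_def)
  also have "\<dots> = exp (- (u $ 1)\<^sup>2 / 2) * exp (- (u $ 2)\<^sup>2 / 2)"
    by (simp only: C)
  also have "\<dots> = exp (- (norm u)\<^sup>2 / 2)"
    unfolding power2_norm_eq_inner
    by (simp add: exp_add [symmetric] inner_vec_def sum_2 power2_eq_square add_divide_distrib)
  finally show ?thesis .
qed

definition gauss_mass :: real where
  "gauss_mass = (LINT v|(lborel :: (real ^ 2) measure). exp (- (norm v)\<^sup>2 / 2))"

lemma gauss_mass_pos: "gauss_mass > 0"
proof -
  have "gauss_mass \<noteq> 0"
  proof
    assume "gauss_mass = 0"
    then have "AE v in (lborel :: (real ^ 2) measure). exp (- (norm v)\<^sup>2 / 2) = 0"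
      unfolding gauss_mass_def
      by (subst (asm) integral_nonneg_eq_0_iff_AE) (use integrable_exp_minus_square in auto)
    then have "(UNIV :: (real ^ 2) set) \<in> null_sets lborel"
      by (subst (asm) AE_iff_null) auto
    then show False by (simp add: null_sets_def)
  qed
  moreover have "gauss_mass \<ge> 0" unfolding gauss_mass_def by (rule Bochner_Integration.integral_nonneg) simp
  ultimately show ?thesis by simp
qed

section \<open>Positivity of averaged autocorrelations\<close>

definition autocorrelation :: "('a :: euclidean_space \<Rightarrow> real) \<Rightarrow> 'a \<Rightarrow> real" where
  "autocorrelation g h = (LINT x|lborel. g x * g (x + h))"

text \<open>
The squared modulus of the Fourier transform, without complex numbers.
\<close>
definition power_spectrum :: "('a :: euclidean_space \<Rightarrow> real) \<Rightarrow> 'a \<Rightarrow> real" where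
  "power_spectrum g \<xi> =
     (LINT x|lborel. g x * cos (\<xi> \<bullet> x))\<^sup>2 + (LINT x|lborel. g x * sin (\<xi> \<bullet> x))\<^sup>2"

locale bounded_continuous_integrable =
  fixes g :: "real ^ 2 \<Rightarrow> real" and B :: real
  assumes cont: "continuous_on UNIV g"
    and bound: "\<bar>g x\<bar> \<le> B"
    and int: "integrable lborel g"
begin

lemma g_borel_measurable [measurable]: "g \<in> borel_measurable borel"
  by (rule borel_measurable_continuous_onI [OF cont])

lemma B_nonneg: "B \<ge> 0"
  using bound [of 0] by linarith

lemma integrable_mult_bounded:
  assumes [measurable]: "f \<in> borel_measurable borel" and "\<And>x. \<bar>f x\<bar> \<le> C"
  shows "integrable lborel (\<lambda>x. g x * f x)"
proof (rule Bochner_Integration.integrable_bound [where f = "\<lambda>x. C * g x"])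
  show "AE x in lborel. norm (g x * f x) \<le> norm (C * g x)"
    using assms(2) by (auto simp: abs_mult mult.commute intro!: mult_right_mono order_trans [OF assms(2)])
qed (use int in auto)

lemma power_spectrum_nonneg: "power_spectrum g \<xi> \<ge> 0"
  by (simp add: power_spectrum_def)

lemma power_spectrum_le: "power_spectrum g \<xi> \<le> 2 * (LINT x|lborel. \<bar>g x\<bar>)\<^sup>2"
proof -
  have *: "(LINT x|lborel. g x * f x)\<^sup>2 \<le> (LINT x|lborel. \<bar>g x\<bar>)\<^sup>2"
    if [measurable]: "f \<in> borel_measurable borel" and f: "\<And>x. \<bar>f x\<bar> \<le> 1" for f
  proof -
    have "\<bar>LINT x|lborel. g x * f x\<bar> \<le> (LINT x|lborel. \<bar>g x * f x\<bar>)"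
      by (rule integral_abs_bound)
    also have "\<dots> \<le> (LINT x|lborel. \<bar>g x\<bar>)"
      using f int integrable_abs [OF integrable_mult_bounded [of f 1]]
      by (intro integral_mono) (auto simp: abs_mult mult_left_le)
    finally show ?thesis by (simp add: abs_le_square_iff [symmetric])
  qed
  show ?thesis
    unfolding power_spectrum_def using *[of "\<lambda>x. cos (\<xi> \<bullet> x)"] *[of "\<lambda>x. sin (\<xi> \<bullet> x)"] by simp
qed

lemma power_spectrum_meas [measurable]: "power_spectrum g \<in> borel_measurable borel"
  unfolding power_spectrum_def [abs_def] by measurable

text \<open>
The sine part of the addition theorem cancels because the integrand is antisymmetric under
exchange of \<open>x\<close> and \<open>y\<close>.
\<close>
lemma double_integral_cos:
  "(LINT x|lborel. (LINT y|lborel. g x * g y * cos (\<xi> \<bullet> (y - x - h))))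
     = cos (\<xi> \<bullet> h) * power_spectrum g \<xi>"
proof -
  define C S where "C = (LINT x|lborel. g x * cos (\<xi> \<bullet> x))" and "S = (LINT x|lborel. g x * sin (\<xi> \<bullet> x))"
  have ic: "integrable lborel (\<lambda>x. g x * cos (\<xi> \<bullet> x))" and si: "integrable lborel (\<lambda>x. g x * sin (\<xi> \<bullet> x))"
    by (rule integrable_mult_bounded [where C = 1]; simp)+
  have "(LINT y|lborel. g x * g y * cos (\<xi> \<bullet> (y - x - h)))
      = g x * cos (\<xi> \<bullet> x) * (cos (\<xi> \<bullet> h) * C + sin (\<xi> \<bullet> h) * S)
      + g x * sin (\<xi> \<bullet> x) * (cos (\<xi> \<bullet> h) * S - sin (\<xi> \<bullet> h) * C)" for x
  proof -
    define P Q where "P = g x * cos (\<xi> \<bullet> (x + h))" and "Q = g x * sin (\<xi> \<bullet> (x + h))"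
    have "g x * g y * cos (\<xi> \<bullet> (y - x - h)) = P * (g y * cos (\<xi> \<bullet> y)) + Q * (g y * sin (\<xi> \<bullet> y))" for y
    proof -
      have "\<xi> \<bullet> (y - x - h) = \<xi> \<bullet> y - \<xi> \<bullet> (x + h)" by (simp add: inner_simps)
      then show ?thesis by (simp only: cos_diff P_def Q_def) (simp add: algebra_simps)
    qed
    then have "(LINT y|lborel. g x * g y * cos (\<xi> \<bullet> (y - x - h))) = P * C + Q * S"
      by (simp add: ic si C_def S_def)
    then show ?thesis
      by (simp add: P_def Q_def inner_simps cos_add sin_add algebra_simps)
  qed
  then have "(LINT x|lborel. (LINT y|lborel. g x * g y * cos (\<xi> \<bullet> (y - x - h))))
      = C * (cos (\<xi> \<bullet> h) * C + sin (\<xi> \<bullet> h) * S) + S * (cos (\<xi> \<bullet> h) * S - sin (\<xi> \<bullet> h) * C)"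
    by (simp add: ic si C_def [symmetric] S_def [symmetric])
  also have "\<dots> = cos (\<xi> \<bullet> h) * (C\<^sup>2 + S\<^sup>2)" by (simp add: algebra_simps power2_eq_square)
  finally show ?thesis by (simp add: power_spectrum_def C_def S_def)
qed

text \<open>
The autocorrelation of \<open>g\<close> at \<open>h\<close>, blurred by a Gaussian of width \<open>1 / s\<close> that has total
mass \<open>gauss_mass\<close> for every \<open>s\<close>.
\<close>
definition smoothed :: "real \<Rightarrow> real ^ 2 \<Rightarrow> real" where
  "smoothed s h = (LINT x|lborel. (LINT v|lborel. g x * g (x + h + v /\<^sub>R s) * exp (- (norm v)\<^sup>2 / 2)))"

text \<open>
Substituting \<open>y = x + h + v / s\<close> turns the blurred autocorrelation into a double integral of
\<open>g x * g y\<close> against a Gaussian in \<open>y - x - h\<close>.  Expanding this Gaussian into cosines and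
exchanging the integrals leaves a mean of the power spectrum.  This is the
substitute for Bochner's theorem: the weight \<open>power_spectrum g\<close> is nonnegative.
\<close>
lemma smoothed_eq:
  assumes "s > 0"
  shows "smoothed s h = s\<^sup>2 * (LINT p|std_normal_pair.
     cos ((s *\<^sub>R vec_of_pair p) \<bullet> h) * power_spectrum g (s *\<^sub>R vec_of_pair p))"
proof -
  interpret P: prob_space std_normal_pair by (rule prob_space_std_normal_pair)
  interpret MP: pair_sigma_finite "lborel \<Otimes>\<^sub>M lborel :: ((real ^ 2) \<times> (real ^ 2)) measure" std_normal_pair
    unfolding lborel_prod ..
  define F where "F z p = g (fst z) * g (snd z) * cos ((s *\<^sub>R vec_of_pair p) \<bullet> (snd z - fst z - h))"
    for z :: "(real ^ 2) \<times> (real ^ 2)" and p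
  have F_meas: "case_prod F \<in> borel_measurable ((lborel \<Otimes>\<^sub>M lborel) \<Otimes>\<^sub>M std_normal_pair)"
    unfolding F_def by measurable
  have gg: "integrable (lborel \<Otimes>\<^sub>M lborel) (\<lambda>z. g (fst z) * g (snd z))"
  proof (rule lborel_pair.Fubini_integrable)
    show "integrable lborel (\<lambda>x. LINT y|lborel. norm (g (fst (x, y)) * g (snd (x, y))))"
      using int by (simp add: abs_mult)
  qed (use int in auto)
  have F_int: "integrable ((lborel \<Otimes>\<^sub>M lborel) \<Otimes>\<^sub>M std_normal_pair) (case_prod F)"
  proof (rule MP.Fubini_integrable [OF F_meas])
    have F1: "\<bar>F z p\<bar> \<le> \<bar>g (fst z) * g (snd z)\<bar>" for z p
      unfolding F_def abs_mult by (intro mult_left_le) auto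
    have Fz: "integrable std_normal_pair (F z)" for z
    proof (rule P.integrable_const_bound)
      show "AE p in std_normal_pair. norm (F z p) \<le> \<bar>g (fst z) * g (snd z)\<bar>"
        using F1 by (intro AE_I2) simp
    qed (unfold F_def [abs_def], measurable)
    then show "AE z in lborel \<Otimes>\<^sub>M lborel. integrable std_normal_pair (\<lambda>p. case (z, p) of (z, p) \<Rightarrow> F z p)"
      by simp
    show "integrable (lborel \<Otimes>\<^sub>M lborel) (\<lambda>z. LINT p|std_normal_pair. norm (case (z, p) of (z, p) \<Rightarrow> F z p))"
    proof (rule Bochner_Integration.integrable_bound [OF gg])
      show "AE z in lborel \<Otimes>\<^sub>M lborel.
          norm (LINT p|std_normal_pair. norm (case (z, p) of (z, p) \<Rightarrow> F z p)) \<le> norm (g (fst z) * g (snd z))"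
      proof (intro AE_I2)
        fix z
        have "(LINT p|std_normal_pair. \<bar>F z p\<bar>) \<le> \<bar>g (fst z) * g (snd z)\<bar>"
          using F1 Fz by (intro P.integral_le_const AE_I2) auto
        then show "norm (LINT p|std_normal_pair. norm (case (z, p) of (z, p) \<Rightarrow> F z p))
            \<le> norm (g (fst z) * g (snd z))"
          by simp
      qed
    qed (use F_meas in measurable)
  qed
  have inner: "(LINT p|std_normal_pair. F (x, y) p) = g x * g y * exp (- (s * norm (y - x - h))\<^sup>2 / 2)" for x y
    using gaussian_as_cosine_mean [of "s *\<^sub>R (y - x - h)"] assms by (simp add: F_def abs_mult)
  have "(LINT p|std_normal_pair. cos ((s *\<^sub>R vec_of_pair p) \<bullet> h) * power_spectrum g (s *\<^sub>R vec_of_pair p))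
      = (LINT p|std_normal_pair. (LINT z|(lborel \<Otimes>\<^sub>M lborel). F z p))"
  proof (rule Bochner_Integration.integral_cong [OF refl])
    fix p
    have "integrable (lborel \<Otimes>\<^sub>M lborel) (\<lambda>z. F z p)"
      by (rule Bochner_Integration.integrable_bound [OF gg])
        (auto simp: F_def abs_mult intro!: mult_left_le)
    then show "cos ((s *\<^sub>R vec_of_pair p) \<bullet> h) * power_spectrum g (s *\<^sub>R vec_of_pair p)
        = (LINT z|(lborel \<Otimes>\<^sub>M lborel). F z p)"
      by (subst lborel_pair.integral_fst' [symmetric])
        (simp_all only: F_def fst_conv snd_conv double_integral_cos)
  qed
  also have "\<dots> = (LINT z|(lborel \<Otimes>\<^sub>M lborel). (LINT p|std_normal_pair. F z p))"
    by (rule MP.Fubini_integral [OF F_int])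
  also have "\<dots> = (LINT x|lborel. (LINT y|lborel. (LINT p|std_normal_pair. F (x, y) p)))"
    using MP.integrable_fst [OF F_int] by (rule lborel_pair.integral_fst' [symmetric])
  also have "\<dots> = (LINT x|lborel. (LINT y|lborel. g x * g y * exp (- (s * norm (y - x - h))\<^sup>2 / 2)))"
    by (simp only: inner)
  also have "\<dots> = (LINT x|lborel. (inverse s) ^ 2 *
      (LINT v|lborel. g x * g (x + h + v /\<^sub>R s) * exp (- (norm v)\<^sup>2 / 2)))"
  proof (rule Bochner_Integration.integral_cong [OF refl])
    fix x
    have [simp]: "s * (inverse s * r) = r" for r using assms by simp
    show "(LINT y|lborel. g x * g y * exp (- (s * norm (y - x - h))\<^sup>2 / 2))
      = (inverse s) ^ 2 * (LINT v|lborel. g x * g (x + h + v /\<^sub>R s) * exp (- (norm v)\<^sup>2 / 2))"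
      using assms
      by (subst lborel_integral_scale [where c = "inverse s" and t = "x + h"])
        simp_all
  qed
  also have "\<dots> = (inverse s) ^ 2 * smoothed s h"
    by (simp only: smoothed_def integral_mult_right_zero)
  finally show ?thesis
    using assms by (simp only: mult.assoc [symmetric] power_mult_distrib [symmetric]) simp
qed

lemma smoothed_inner_le:
  fixes y :: "real ^ 2 \<Rightarrow> real ^ 2"
  assumes [measurable]: "y \<in> borel_measurable borel"
  shows "\<bar>LINT v|lborel. g x * g (y v) * exp (- (norm v)\<^sup>2 / 2)\<bar> \<le> \<bar>g x\<bar> * (B * gauss_mass)"
proof -
  have le: "\<bar>g x * g (y v) * exp (- (norm v)\<^sup>2 / 2)\<bar> \<le> \<bar>g x\<bar> * B * exp (- (norm v)\<^sup>2 / 2)" for v :: "real ^ 2"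
    unfolding abs_mult using bound B_nonneg by (intro mult_mono) auto
  have int': "integrable lborel (\<lambda>v :: real ^ 2. \<bar>g x\<bar> * B * exp (- (norm v)\<^sup>2 / 2))"
    by (intro integrable_mult_right integrable_exp_minus_square)
  have "\<bar>LINT v|lborel. g x * g (y v) * exp (- (norm v)\<^sup>2 / 2)\<bar>
      \<le> (LINT v|(lborel :: (real ^ 2) measure). \<bar>g x\<bar> * B * exp (- (norm v)\<^sup>2 / 2))"
  proof -
    have "integrable lborel (\<lambda>v. g x * g (y v) * exp (- (norm v)\<^sup>2 / 2))"
    proof (rule Bochner_Integration.integrable_bound [OF int'])
      show "AE v in lborel. norm (g x * g (y v) * exp (- (norm v)\<^sup>2 / 2))
          \<le> norm (\<bar>g x\<bar> * B * exp (- (norm v)\<^sup>2 / 2))"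
        unfolding real_norm_def by (intro AE_I2 order_trans [OF le abs_ge_self])
    qed measurable
    from Bochner_Integration.integral_norm_bound_integral [OF this int', unfolded real_norm_def, OF le]
    show ?thesis .
  qed
  also have "\<dots> = \<bar>g x\<bar> * (B * gauss_mass)" by (simp add: gauss_mass_def)
  finally show ?thesis .
qed

lemma smoothed_outer_integrable:
  "integrable lborel (\<lambda>x. LINT v|lborel. g x * g (x + h + v /\<^sub>R s) * exp (- (norm v)\<^sup>2 / 2))"
proof (rule Bochner_Integration.integrable_bound)
  show "integrable lborel (\<lambda>x. \<bar>g x\<bar> * (B * gauss_mass))"
    using int by (intro integrable_mult_left integrable_abs)
  show "AE x in lborel. norm (LINT v|lborel. g x * g (x + h + v /\<^sub>R s) * exp (- (norm v)\<^sup>2 / 2))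
      \<le> norm (\<bar>g x\<bar> * (B * gauss_mass))"
    unfolding real_norm_def by (intro AE_I2 order_trans [OF smoothed_inner_le abs_ge_self]) measurable
qed measurable

lemma smoothed_le: "\<bar>smoothed s h\<bar> \<le> (LINT x|lborel. \<bar>g x\<bar>) * (B * gauss_mass)"
proof -
  have "\<bar>smoothed s h\<bar> \<le> (LINT x|lborel. \<bar>g x\<bar> * (B * gauss_mass))"
    unfolding smoothed_def
    using Bochner_Integration.integral_norm_bound_integral [OF smoothed_outer_integrable [of h s],
        where g = "\<lambda>x. \<bar>g x\<bar> * (B * gauss_mass)"] int smoothed_inner_le
    by simp
  then show ?thesis by simp
qed

text \<open>
The continuity of \<open>g\<close> enters here: the values \<open>g (x + h + v / s)\<close> seen by the blurring
converge to \<open>g (x + h)\<close> at every point.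
\<close>
lemma smoothed_tendsto: "(\<lambda>n. smoothed (real (Suc n)) h) \<longlonglongrightarrow> gauss_mass * autocorrelation g h"
proof -
  have inner: "(\<lambda>n. LINT v|lborel. g x * g (x + h + v /\<^sub>R real (Suc n)) * exp (- (norm v)\<^sup>2 / 2))
      \<longlonglongrightarrow> (LINT v|(lborel :: (real ^ 2) measure). g x * g (x + h) * exp (- (norm v)\<^sup>2 / 2))" for x
  proof (rule integral_dominated_convergence [where w = "\<lambda>v. \<bar>g x\<bar> * B * exp (- (norm v)\<^sup>2 / 2)"])
    show "integrable lborel (\<lambda>v :: real ^ 2. \<bar>g x\<bar> * B * exp (- (norm v)\<^sup>2 / 2))"
      by (intro integrable_mult_right integrable_exp_minus_square)
    show "AE v in lborel. norm (g x * g (x + h + v /\<^sub>R real (Suc n)) * exp (- (norm v)\<^sup>2 / 2))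
        \<le> \<bar>g x\<bar> * B * exp (- (norm v)\<^sup>2 / 2)" for n
      unfolding real_norm_def abs_mult using bound B_nonneg by (intro AE_I2 mult_mono) auto
    show "AE v in (lborel :: (real ^ 2) measure). (\<lambda>n. g x * g (x + h + v /\<^sub>R real (Suc n)) * exp (- (norm v)\<^sup>2 / 2))
        \<longlonglongrightarrow> g x * g (x + h) * exp (- (norm v)\<^sup>2 / 2)"
    proof (intro AE_I2 tendsto_mult tendsto_const)
      fix v :: "real ^ 2"
      have "(\<lambda>n. x + h + v /\<^sub>R real (Suc n)) \<longlonglongrightarrow> x + h + 0 *\<^sub>R v"
        by (intro tendsto_add tendsto_const tendsto_scaleR LIMSEQ_inverse_real_of_nat)
      then show "(\<lambda>n. g (x + h + v /\<^sub>R real (Suc n))) \<longlonglongrightarrow> g (x + h)"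
        using continuous_on_tendsto_compose [OF cont] by simp
    qed
  qed measurable
  have "(\<lambda>n. smoothed (real (Suc n)) h)
      \<longlonglongrightarrow> (LINT x|lborel. (LINT v|(lborel :: (real ^ 2) measure). g x * g (x + h) * exp (- (norm v)\<^sup>2 / 2)))"
    unfolding smoothed_def
  proof (rule integral_dominated_convergence [where w = "\<lambda>x. \<bar>g x\<bar> * (B * gauss_mass)"])
    show "integrable lborel (\<lambda>x. \<bar>g x\<bar> * (B * gauss_mass))"
      using int by (intro integrable_mult_left integrable_abs)
  qed (use inner smoothed_inner_le in auto)
  also have "(LINT x|lborel. (LINT v|(lborel :: (real ^ 2) measure). g x * g (x + h) * exp (- (norm v)\<^sup>2 / 2)))
      = gauss_mass * autocorrelation g h"
    by (simp add: gauss_mass_def autocorrelation_def mult.commute)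
  finally show ?thesis .
qed

lemma autocorrelation_meas [measurable]: "autocorrelation g \<in> borel_measurable borel"
  unfolding autocorrelation_def [abs_def] by measurable

lemma smoothed_meas [measurable]: "smoothed s \<in> borel_measurable borel"
  unfolding smoothed_def [abs_def] by measurable

lemma smoothed_rotation_mean:
  assumes "s > 0"
  shows "(LINT \<theta>|uniform_angle. smoothed s (rotation \<theta> v)) = s\<^sup>2 * (LINT p|std_normal_pair.
     bessel_J0 (s * norm (vec_of_pair p) * norm v) * power_spectrum g (s *\<^sub>R vec_of_pair p))"
proof -
  interpret P: prob_space std_normal_pair by (rule prob_space_std_normal_pair)
  interpret U: prob_space uniform_angle by (rule prob_space_uniform_angle)
  interpret PU: pair_prob_space std_normal_pair uniform_angle ..
  define F where "F p \<theta> = cos ((s *\<^sub>R vec_of_pair p) \<bullet> rotation \<theta> v) * power_spectrum g (s *\<^sub>R vec_of_pair p)" for p \<theta>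
  have F_meas: "case_prod F \<in> borel_measurable (std_normal_pair \<Otimes>\<^sub>M uniform_angle)"
    unfolding F_def by measurable
  have "\<bar>F p \<theta>\<bar> \<le> 2 * (LINT x|lborel. \<bar>g x\<bar>)\<^sup>2" for p \<theta>
  proof -
    have "\<bar>F p \<theta>\<bar> \<le> 1 * power_spectrum g (s *\<^sub>R vec_of_pair p)"
      unfolding F_def abs_mult using power_spectrum_nonneg by (intro mult_mono) auto
    then show ?thesis using power_spectrum_le order_trans by fastforce
  qed
  then have F_int: "integrable (std_normal_pair \<Otimes>\<^sub>M uniform_angle) (case_prod F)"
    using F_meas by (intro PU.integrable_const_bound [where B = "2 * (LINT x|lborel. \<bar>g x\<bar>)\<^sup>2"]) auto
  have inner: "(LINT \<theta>|uniform_angle. F p \<theta>)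
      = bessel_J0 (s * norm (vec_of_pair p) * norm v) * power_spectrum g (s *\<^sub>R vec_of_pair p)" for p
    using bessel_J0_rotation_mean [of "s *\<^sub>R vec_of_pair p" v] assms by (simp add: F_def)
  have "(LINT \<theta>|uniform_angle. smoothed s (rotation \<theta> v))
      = s\<^sup>2 * (LINT \<theta>|uniform_angle. (LINT p|std_normal_pair. F p \<theta>))"
    by (simp add: smoothed_eq [OF assms] F_def)
  also have "(LINT \<theta>|uniform_angle. (LINT p|std_normal_pair. F p \<theta>))
      = (LINT p|std_normal_pair. (LINT \<theta>|uniform_angle. F p \<theta>))"
    by (rule PU.Fubini_integral [OF F_int])
  finally show ?thesis unfolding inner .
qed

text \<open>
Averaging over rotations turns the cosine at frequency \<open>\<xi>\<close> and displacement \<open>v\<close> into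
\<open>J0 (norm \<xi> * norm v)\<close>.  The assumption says that the radial weight by which the power spectrum
is multiplied is nonnegative at every frequency.  Positivity holds for each width of the
Gaussian, hence in the limit.
\<close>
theorem angular_mean_autocorrelation_nonneg:
  assumes pos: "\<And>t. t \<ge> 0 \<Longrightarrow> 0 \<le> (\<Sum>i\<in>I. w i * bessel_J0 (t * norm (v i)))"
  shows "0 \<le> (\<Sum>i\<in>I. w i * (LINT \<theta>|uniform_angle. autocorrelation g (rotation \<theta> (v i))))"
proof -
  interpret P: prob_space std_normal_pair by (rule prob_space_std_normal_pair)
  interpret U: prob_space uniform_angle by (rule prob_space_uniform_angle)
  have nonneg: "0 \<le> (\<Sum>i\<in>I. w i * (LINT \<theta>|uniform_angle. smoothed s (rotation \<theta> (v i))))"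
    if s: "s > 0" for s
  proof -
    define F where "F i p = bessel_J0 (s * norm (vec_of_pair p) * norm (v i)) * power_spectrum g (s *\<^sub>R vec_of_pair p)" for i p
    have "integrable std_normal_pair (F i)" for i
    proof (rule P.integrable_const_bound)
      show "F i \<in> borel_measurable std_normal_pair" unfolding F_def [abs_def] by measurable
      show "AE p in std_normal_pair. norm (F i p) \<le> 1 * (2 * (LINT x|lborel. \<bar>g x\<bar>)\<^sup>2)"
      proof (intro AE_I2)
        fix p
        have "\<bar>power_spectrum g (s *\<^sub>R vec_of_pair p)\<bar> \<le> 2 * (LINT x|lborel. \<bar>g x\<bar>)\<^sup>2"
          using power_spectrum_nonneg power_spectrum_le by simp
        then show "norm (F i p) \<le> 1 * (2 * (LINT x|lborel. \<bar>g x\<bar>)\<^sup>2)"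
          unfolding F_def real_norm_def abs_mult by (intro mult_mono [OF abs_bessel_J0_le]) auto
      qed
    qed
    then have "s\<^sup>2 * (LINT p|std_normal_pair. (\<Sum>i\<in>I. w i * F i p))
        = (\<Sum>i\<in>I. s\<^sup>2 * (w i * (LINT p|std_normal_pair. F i p)))"
      by (simp add: sum_distrib_left)
    also have "\<dots> = (\<Sum>i\<in>I. w i * (LINT \<theta>|uniform_angle. smoothed s (rotation \<theta> (v i))))"
      unfolding smoothed_rotation_mean [OF s] F_def by (simp only: mult.left_commute)
    finally have eq: "(\<Sum>i\<in>I. w i * (LINT \<theta>|uniform_angle. smoothed s (rotation \<theta> (v i))))
        = s\<^sup>2 * (LINT p|std_normal_pair. (\<Sum>i\<in>I. w i * F i p))" ..
    have "0 \<le> (\<Sum>i\<in>I. w i * F i p)" for p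
    proof -
      have "(\<Sum>i\<in>I. w i * F i p) =
          (\<Sum>i\<in>I. w i * bessel_J0 (s * norm (vec_of_pair p) * norm (v i))) * power_spectrum g (s *\<^sub>R vec_of_pair p)"
        by (simp add: F_def sum_distrib_right mult.assoc)
      then show ?thesis using pos [of "s * norm (vec_of_pair p)"] s power_spectrum_nonneg by simp
    qed
    then show ?thesis unfolding eq by (intro mult_nonneg_nonneg Bochner_Integration.integral_nonneg) auto
  qed
  have lim: "(\<lambda>n. LINT \<theta>|uniform_angle. smoothed (real (Suc n)) (rotation \<theta> u))
      \<longlonglongrightarrow> (LINT \<theta>|uniform_angle. gauss_mass * autocorrelation g (rotation \<theta> u))" for u
  proof (rule integral_dominated_convergence [where w = "\<lambda>_. (LINT x|lborel. \<bar>g x\<bar>) * (B * gauss_mass)"])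
  qed (use smoothed_tendsto smoothed_le in auto)
  have "0 \<le> (\<Sum>i\<in>I. w i * (LINT \<theta>|uniform_angle. gauss_mass * autocorrelation g (rotation \<theta> (v i))))"
  proof (rule LIMSEQ_le_const)
    show "(\<lambda>n. \<Sum>i\<in>I. w i * (LINT \<theta>|uniform_angle. smoothed (real (Suc n)) (rotation \<theta> (v i))))
        \<longlonglongrightarrow> (\<Sum>i\<in>I. w i * (LINT \<theta>|uniform_angle. gauss_mass * autocorrelation g (rotation \<theta> (v i))))"
      by (intro tendsto_sum tendsto_mult tendsto_const lim)
  qed (use nonneg in auto)
  also have "\<dots> = gauss_mass * (\<Sum>i\<in>I. w i * (LINT \<theta>|uniform_angle. autocorrelation g (rotation \<theta> (v i))))"
    by (simp add: sum_distrib_left mult_ac)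
  finally show ?thesis using gauss_mass_pos by (simp add: zero_le_mult_iff)
qed

end

section \<open>Continuous approximation of a colouring\<close>

text \<open>
Inner and outer regularity leave a set of small measure between a closed set inside \<open>S\<close> and an
open set around it; Urysohn's lemma bridges the gap.
\<close>
lemma indicator_approx_continuous:
  fixes S :: "'a :: euclidean_space set" and e :: real
  assumes "S \<in> sets lebesgue" "e > 0"
  obtains g :: "'a \<Rightarrow> real" and E where "continuous_on UNIV g" "\<And>x. 0 \<le> g x" "\<And>x. g x \<le> 1"
    "E \<in> sets borel" "emeasure lborel E < ennreal e" "\<And>x. x \<notin> E \<Longrightarrow> g x = indicator S x"
proof -
  obtain T where T: "closed T" "T \<subseteq> S" "S - T \<in> lmeasurable" "emeasure lebesgue (S - T) < ennreal (e / 2)"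
    using sets_lebesgue_inner_closed [OF assms(1), of "e / 2"] assms(2) by auto
  obtain U where U: "open U" "S \<subseteq> U" "U - S \<in> lmeasurable" "emeasure lebesgue (U - S) < ennreal (e / 2)"
    using sets_lebesgue_outer_open [OF assms(1), of "e / 2"] assms(2) by auto
  obtain g :: "'a \<Rightarrow> real" where g: "continuous_on UNIV g" "\<And>x. g x \<in> closed_segment 1 0"
      "\<And>x. x \<in> T \<Longrightarrow> g x = 1" "\<And>x. x \<in> - U \<Longrightarrow> g x = 0"
    by (rule Urysohn [of T "- U" "1::real" 0]) (use T U in auto)
  have "emeasure lebesgue (U - T) = emeasure lebesgue ((S - T) \<union> (U - S))"
    using T U by (intro arg_cong [where f = "emeasure lebesgue"]) auto
  also have "\<dots> \<le> emeasure lebesgue (S - T) + emeasure lebesgue (U - S)"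
    using T U by (intro emeasure_subadditive) auto
  also have "\<dots> < ennreal (e / 2) + ennreal (e / 2)"
    using T U by (intro add_strict_mono) auto
  also have "\<dots> = ennreal e" using assms(2) by (simp add: ennreal_plus [symmetric] del: ennreal_plus)
  finally have "emeasure lborel (U - T) < ennreal e" using T U by simp
  then show ?thesis
    using T U g by (intro that [of g "U - T"]) (auto simp: closed_segment_eq_real_ivl indicator_def)
qed

definition truncated_sign :: "'a :: real_normed_vector set \<Rightarrow> real \<Rightarrow> 'a \<Rightarrow> real" where
  "truncated_sign A R x = (if x \<in> ball 0 R then if x \<in> A then 1 else - 1 else 0)"

text \<open>
The approximation is exact off a Borel set of measure less than 1.  A fixed bound
suffices, since the estimates below are compared with quantities of the order of \<open>R\<^sup>2\<close>.
\<close>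
lemma truncated_sign_approx_continuous:
  fixes A :: "'a :: euclidean_space set"
  assumes "A \<in> sets lebesgue"
  obtains g E where "continuous_on UNIV g" "\<And>x. \<bar>g x\<bar> \<le> 1" "integrable lborel g"
    "E \<in> sets borel" "emeasure lborel E < 1" "\<And>x. x \<notin> E \<Longrightarrow> g x = truncated_sign A R x"
proof -
  have "A \<inter> ball 0 R \<in> sets lebesgue" "ball 0 R - A \<in> sets lebesgue" using assms by auto
  note S = this
  obtain g1 :: "'a \<Rightarrow> real" and E1 where
    1: "continuous_on UNIV g1" "\<And>x. 0 \<le> g1 x" "\<And>x. g1 x \<le> 1" "E1 \<in> sets borel"
      "emeasure lborel E1 < ennreal (1 / 2)" "\<And>x. x \<notin> E1 \<Longrightarrow> g1 x = indicator (A \<inter> ball 0 R) x"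
    by (rule indicator_approx_continuous [OF S(1), of "1 / 2"]) auto
  obtain g2 :: "'a \<Rightarrow> real" and E2 where
    2: "continuous_on UNIV g2" "\<And>x. 0 \<le> g2 x" "\<And>x. g2 x \<le> 1" "E2 \<in> sets borel"
      "emeasure lborel E2 < ennreal (1 / 2)" "\<And>x. x \<notin> E2 \<Longrightarrow> g2 x = indicator (ball 0 R - A) x"
    by (rule indicator_approx_continuous [OF S(2), of "1 / 2"]) auto
  define g where "g x = g1 x - g2 x" for x
  define E where "E = E1 \<union> E2"
  have E: "E \<in> sets borel" using 1 2 by (simp add: E_def)
  have g: "continuous_on UNIV g" unfolding g_def using 1 2 by (intro continuous_intros)
  have g1: "\<bar>g x\<bar> \<le> 1" for x using 1(2,3) [of x] 2(2,3) [of x] by (simp add: g_def)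
  have gE: "g x = truncated_sign A R x" if "x \<notin> E" for x
    using that 1(6) [of x] 2(6) [of x] by (simp add: g_def E_def truncated_sign_def)
  have "emeasure lborel E \<le> emeasure lborel E1 + emeasure lborel E2"
    unfolding E_def using 1 2 by (intro emeasure_subadditive) auto
  also have "\<dots> < ennreal (1 / 2) + ennreal (1 / 2)"
    using 1 2 by (intro add_strict_mono) auto
  also have "\<dots> = 1" by (subst ennreal_plus [symmetric]) auto
  finally have mE: "emeasure lborel E < 1" .
  have "integrable lborel g"
  proof (rule Bochner_Integration.integrable_bound)
    show "integrable lborel (\<lambda>x. indicator (ball 0 R) x + indicator E x :: real)"
      using E mE emeasure_lborel_ball_finite [of "0 :: 'a" R] order.strict_trans [OF mE]
      by (intro Bochner_Integration.integrable_add integrable_real_indicator) auto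
    show "g \<in> borel_measurable lborel"
      using borel_measurable_continuous_onI [OF g] by simp
    have "\<bar>g x\<bar> \<le> indicator (ball 0 R) x + indicator E x" for x
      using g1 [of x] gE [of x] by (cases "x \<in> E") (auto simp: truncated_sign_def indicator_def)
    then show "AE x in lborel. norm (g x) \<le> norm (indicator (ball 0 R) x + indicator E x :: real)"
      by (intro AE_I2) (simp add: abs_of_nonneg)
  qed
  from that [OF g g1 this E mE gE] show ?thesis .
qed

section \<open>Counting in a colouring without monochromatic triples\<close>

lemma pairwise_products_le_3:
  fixes p q r :: real
  assumes "\<bar>p\<bar> \<le> 1" "\<bar>q\<bar> \<le> 1" "\<bar>r\<bar> \<le> 1"
  shows "p * q + p * r + q * r \<le> 3"
proof -
  have "x * y \<le> 1" if "\<bar>x\<bar> \<le> 1" "\<bar>y\<bar> \<le> 1" for x y :: real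
    using mult_mono [OF that] by (simp add: abs_mult [symmetric])
  from this [of p q] this [of p r] this [of q r] assms show ?thesis by simp
qed

context bounded_continuous_integrable
begin

lemma abs_autocorrelation_le: "\<bar>autocorrelation g h\<bar> \<le> (LINT x|lborel. \<bar>g x\<bar> * B)"
  unfolding autocorrelation_def
proof (rule Bochner_Integration.integral_abs_bound_integral)
  show "integrable lborel (\<lambda>x. g x * g (x + h))" by (rule integrable_mult_bounded [OF _ bound]) simp
  show "integrable lborel (\<lambda>x. \<bar>g x\<bar> * B)" using int by simp
  show "\<bar>g x * g (x + h)\<bar> \<le> \<bar>g x\<bar> * B" for x
    unfolding abs_mult using bound by (intro mult_left_mono) auto
qed

text \<open>
Translating by \<open>s\<close> makes all three autocorrelations integrals over the base point of one and the
same triple \<open>x\<close>, \<open>x + s\<close>, \<open>x + z\<close>.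
\<close>
lemma autocorrelation_sum3:
  "autocorrelation g s + autocorrelation g z + autocorrelation g (z - s)
     = (LINT x|lborel. g x * g (x + s) + g x * g (x + z) + g (x + s) * g (x + z))"
    (is "_ = ?rhs")
  and autocorrelation_sum3_integrable:
  "integrable lborel (\<lambda>x. g x * g (x + s) + g x * g (x + z) + g (x + s) * g (x + z))"
proof -
  have i: "integrable lborel (\<lambda>x. g x * g (x + h))" for h
    by (rule integrable_mult_bounded [OF _ bound]) simp
  have eq: "(\<lambda>x. g (x + s) * g (x + z)) = (\<lambda>x. (\<lambda>x. g x * g (x + (z - s))) (x + s))" by simp
  have j: "integrable lborel (\<lambda>x. g (x + s) * g (x + z))"
    unfolding eq by (rule lborel_integrable_shift [OF i])
  have k: "autocorrelation g (z - s) = (LINT x|lborel. g (x + s) * g (x + z))"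
    unfolding eq autocorrelation_def by (rule lborel_integral_shift [symmetric]) simp
  show "autocorrelation g s + autocorrelation g z + autocorrelation g (z - s) = ?rhs"
    unfolding k unfolding autocorrelation_def using i j by simp
  show "integrable lborel (\<lambda>x. g x * g (x + s) + g x * g (x + z) + g (x + s) * g (x + z))"
    using i j by simp
qed

end

text \<open>
Among three signs that are not all equal, the pairwise products add up to \<open>- 1\<close>.  So without a
monochromatic triple, the integrand in \<open>autocorrelation_sum3\<close> is \<open>- 1\<close> whenever the three
points lie in the ball of radius \<open>R\<close> and avoid \<open>E\<close>.  The annulus between \<open>R - \<rho>\<close> and
\<open>R + \<rho>\<close> and the set \<open>E\<close> contribute an error of order \<open>R\<close> only.
\<close>
lemma autocorrelation_sum3_le:
  assumes "bounded_continuous_integrable g 1"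
    and E: "E \<in> sets borel" "emeasure lborel E < 1"
    and gE: "\<And>x. x \<notin> E \<Longrightarrow> g x = truncated_sign A R x"
    and no_mono: "\<And>x. \<not> monochromatic A (- A) {x, x + s, x + z}"
    and le: "norm s \<le> \<rho>" "norm z \<le> \<rho>" "\<rho> \<le> R"
  shows "autocorrelation g s + autocorrelation g z + autocorrelation g (z - s)
    \<le> 3 * pi * (R + \<rho>)\<^sup>2 - 4 * pi * (R - \<rho>)\<^sup>2 + 18"
proof -
  interpret bounded_continuous_integrable g 1 by fact
  \<comment> \<open>Without its last summand, \<open>D\<close> is \<open>- 1\<close> on the small ball and 3 on the annulus.  Each of
    the three points that falls into \<open>E\<close> adds 6, more than enough to exceed the trivial bound 3.\<close>
  define D where "D x = 3 * indicator (ball 0 (R + \<rho>)) x - 4 * indicator (ball 0 (R - \<rho>)) x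
      + 6 * (indicator E x + indicator E (x + s) + indicator E (x + z) :: real)" for x :: "real ^ 2"
  have \<rho>: "\<rho> \<ge> 0" using le(1) norm_ge_zero order_trans by blast
  have iE: "integrable lborel (indicator E :: real ^ 2 \<Rightarrow> real)"
    using E order.strict_trans [OF E(2)] by (intro integrable_real_indicator) auto
  have iB: "integrable lborel (indicator (ball 0 r) :: real ^ 2 \<Rightarrow> real)" for r
    using emeasure_lborel_ball_finite by (intro integrable_real_indicator) auto
  have iE': "integrable lborel (\<lambda>x. indicator E (x + t) :: real)" for t :: "real ^ 2"
    by (rule lborel_integrable_shift [OF iE])
  have mE: "measure lborel E \<le> 1"
    using E(2) by (simp add: measure_def enn2real_leI order_less_imp_le)
  have mE': "(LINT x|lborel. indicator E (x + t)) = measure lborel E" for t :: "real ^ 2"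
    using lborel_integral_shift [of "indicator E :: real ^ 2 \<Rightarrow> real" t] E by simp
  have "g x * g (x + s) + g x * g (x + z) + g (x + s) * g (x + z) \<le> D x" for x
  proof (cases "x \<in> E \<or> x + s \<in> E \<or> x + z \<in> E")
    case True
    then have "indicator E x + indicator E (x + s) + indicator E (x + z) \<ge> (1 :: real)"
      by (auto simp: indicator_def)
    moreover have "indicator (ball 0 (R - \<rho>)) x \<le> (indicator (ball 0 (R + \<rho>)) x :: real)"
      "indicator (ball 0 (R - \<rho>)) x \<le> (1 :: real)"
      using \<rho> by (auto simp: indicator_def)
    moreover have "3 * p - 4 * q + 6 * e \<ge> 3" if "1 \<le> e" "q \<le> p" "q \<le> 1" for p q e :: real
      using that by linarith
    ultimately have "D x \<ge> 3" unfolding D_def by blast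
    then show ?thesis using pairwise_products_le_3 [OF bound bound bound] order_trans by blast
  next
    case False
    then have g: "g x = truncated_sign A R x" "g (x + s) = truncated_sign A R (x + s)"
      "g (x + z) = truncated_sign A R (x + z)" and D: "D x = 3 * indicator (ball 0 (R + \<rho>)) x - 4 * indicator (ball 0 (R - \<rho>)) x"
      by (auto simp: gE D_def)
    have n: "norm (x + s) \<le> norm x + \<rho>" "norm (x + z) \<le> norm x + \<rho>"
      "norm x \<le> norm (x + s) + \<rho>" "norm x \<le> norm (x + z) + \<rho>"
      using le norm_triangle_ineq [of x s] norm_triangle_ineq [of x z]
        norm_triangle_ineq4 [of "x + s" s] norm_triangle_ineq4 [of "x + z" z] by auto
    consider "norm x < R - \<rho>" | "R - \<rho> \<le> norm x" "norm x < R + \<rho>" | "R + \<rho> \<le> norm x" by linarith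
    then show ?thesis
    proof cases
      case 1
      then have "norm x < R" "norm (x + s) < R" "norm (x + z) < R" "norm x < R + \<rho>" using n \<rho> by auto
      then show ?thesis using no_mono [of x] 1
        unfolding g D by (auto simp: truncated_sign_def monochromatic_def split: if_splits)
    next
      case 2
      then have "D x = 3" unfolding D by simp
      then show ?thesis using pairwise_products_le_3 [OF bound bound bound] by metis
    next
      case 3
      then have "\<not> norm x < R" "\<not> norm (x + s) < R" "\<not> norm (x + z) < R" "\<not> norm x < R - \<rho>" using n \<rho> by auto
      then show ?thesis using 3 unfolding g D by (simp add: truncated_sign_def)
    qed
  qed
  then have "autocorrelation g s + autocorrelation g z + autocorrelation g (z - s) \<le> (LINT x|lborel. D x)"
    unfolding autocorrelation_sum3 D_def using iE iB iE'
    by (intro integral_mono autocorrelation_sum3_integrable) auto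
  also have "\<dots> = 3 * (pi * (R + \<rho>)\<^sup>2) - 4 * (pi * (R - \<rho>)\<^sup>2) + 18 * measure lborel E"
    unfolding D_def using iE iB iE' \<rho> le
    by (simp add: mE' E circle_area mult.commute)
  finally show ?thesis using mE by simp
qed

lemma autocorrelation_0_le:
  assumes "bounded_continuous_integrable g 1"
    and E: "E \<in> sets borel" "emeasure lborel E < 1"
    and gE: "\<And>x. x \<notin> E \<Longrightarrow> g x = truncated_sign A R x"
    and "R \<ge> 0"
  shows "autocorrelation g 0 \<le> pi * R\<^sup>2 + 1"
proof -
  interpret bounded_continuous_integrable g 1 by fact
  have iE: "integrable lborel (indicator E :: real ^ 2 \<Rightarrow> real)"
    using E order.strict_trans [OF E(2)] by (intro integrable_real_indicator) auto
  have iB: "integrable lborel (indicator (ball 0 R) :: real ^ 2 \<Rightarrow> real)"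
    using emeasure_lborel_ball_finite by (intro integrable_real_indicator) auto
  have mE: "measure lborel E \<le> 1"
    using E(2) by (simp add: measure_def enn2real_leI order_less_imp_le)
  have "g x * g x \<le> indicator (ball 0 R) x + indicator E x" for x
  proof (cases "x \<in> E")
    case True
    have "g x * g x \<le> 1" using bound [of x] abs_square_le_1 [of "g x"] by (simp add: power2_eq_square)
    with True show ?thesis by (simp add: indicator_def)
  qed (simp add: gE truncated_sign_def)
  then have "autocorrelation g 0 \<le> (LINT x|lborel. indicator (ball 0 R) x + indicator E x)"
    unfolding autocorrelation_def using iE iB integrable_mult_bounded [OF g_borel_measurable bound]
    by (intro integral_mono) auto
  also have "\<dots> = pi * R\<^sup>2 + measure lborel E"
    using iE iB E \<open>R \<ge> 0\<close> by (simp add: circle_area)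
  finally show ?thesis using mE by simp
qed

text \<open>
Suppose that there is no such triple.  The positivity theorem for the displacements \<open>0\<close>, \<open>u\<close>,
\<open>w\<close>, \<open>w - u\<close> with weights \<open>1 - \<delta>\<close>, 1, 1, 1 gives the lower bound 0 for a sum of
averaged autocorrelations, whereas counting bounds this sum from above by
\<open>(1 - \<delta>) * pi * R\<^sup>2 - pi * R\<^sup>2\<close> up to an error of order \<open>R\<close>.
\<close>
theorem monochromatic_rotated_triple:
  fixes u w :: "real ^ 2"
  assumes A: "A \<in> sets lebesgue" and \<delta>: "0 < \<delta>" "\<delta> \<le> 1"
    and J: "\<And>t. t \<ge> 0 \<Longrightarrow>
      bessel_J0 (t * norm u) + bessel_J0 (t * norm w) + bessel_J0 (t * norm (w - u)) \<ge> - 1 + \<delta>"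
  shows "\<exists>x \<theta>. monochromatic A (- A) {x, x + rotation \<theta> u, x + rotation \<theta> w}"
proof (rule ccontr)
  assume no_mono: "\<not> ?thesis"
  interpret U: prob_space uniform_angle by (rule prob_space_uniform_angle)
  define \<rho> where "\<rho> = max (norm u) (norm w)"
  \<comment> \<open>Large enough for the gain \<open>\<delta> * pi * R\<^sup>2\<close> to beat the error \<open>14 * pi * R * \<rho> + 19\<close>.\<close>
  define R where "R = \<rho> + (14 * \<rho> + 7) / \<delta>"
  have \<rho>: "\<rho> \<ge> 0" "norm u \<le> \<rho>" "norm w \<le> \<rho>" by (auto simp: \<rho>_def max_def)
  have "(14 * \<rho> + 7) / \<delta> \<ge> 14 * \<rho> + 7"
    using \<delta> \<rho> mult_left_le [of \<delta> "14 * \<rho> + 7"] by (simp add: le_divide_eq)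
  then have R: "R \<ge> 7" "\<rho> \<le> R" using \<rho> by (auto simp: R_def)
  have \<delta>R: "\<delta> * R \<ge> 14 * \<rho> + 7" using \<delta> \<rho> unfolding R_def distrib_left by simp
  obtain g E where g: "continuous_on UNIV g" "\<And>x. \<bar>g x\<bar> \<le> 1" "integrable lborel g"
    and E: "E \<in> sets borel" "emeasure lborel E < 1" "\<And>x. x \<notin> E \<Longrightarrow> g x = truncated_sign A R x"
    using truncated_sign_approx_continuous [OF A] by metis
  have loc: "bounded_continuous_integrable g 1" using g by unfold_locales
  interpret bounded_continuous_integrable g 1 by (rule loc)
  define mean where "mean v = (LINT \<theta>|uniform_angle. autocorrelation g (rotation \<theta> v))" for v
  define M where "M = 3 * pi * (R + \<rho>)\<^sup>2 - 4 * pi * (R - \<rho>)\<^sup>2 + 18"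
  have intK: "integrable uniform_angle (\<lambda>\<theta>. autocorrelation g (rotation \<theta> v))" for v
    using abs_autocorrelation_le
    by (intro U.integrable_const_bound [where B = "LINT x|lborel. \<bar>g x\<bar> * 1"]) auto
  have "mean u + mean w + mean (w - u) = (LINT \<theta>|uniform_angle. autocorrelation g (rotation \<theta> u)
      + autocorrelation g (rotation \<theta> w) + autocorrelation g (rotation \<theta> (w - u)))"
    using intK by (simp add: mean_def)
  also have "\<dots> \<le> M"
  proof (rule U.integral_le_const)
    show "AE \<theta> in uniform_angle. autocorrelation g (rotation \<theta> u)
      + autocorrelation g (rotation \<theta> w) + autocorrelation g (rotation \<theta> (w - u)) \<le> M"
      unfolding M_def rotation_diff using no_mono \<rho> R
      by (intro AE_I2 autocorrelation_sum3_le [OF loc E]) (auto simp: norm_rotation)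
  qed (use intK in simp)
  finally have upper: "mean u + mean w + mean (w - u) \<le> M" .
  define v where "v = (!) [0, u, w, w - u]"
  have "0 \<le> (\<Sum>i<4::nat. (if i = 0 then 1 - \<delta> else 1) * (LINT \<theta>|uniform_angle. autocorrelation g (rotation \<theta> (v i))))"
  proof (rule angular_mean_autocorrelation_nonneg)
    fix t :: real
    assume "t \<ge> 0"
    from J [OF this] show "0 \<le> (\<Sum>i<4::nat. (if i = 0 then 1 - \<delta> else 1) * bessel_J0 (t * norm (v i)))"
      by (simp add: v_def eval_nat_numeral bessel_J0_0)
  qed
  then have "0 \<le> (1 - \<delta>) * mean 0 + (mean u + mean w + mean (w - u))"
    by (simp add: v_def eval_nat_numeral mean_def)
  also have "mean 0 = autocorrelation g 0"
    using rotation_scaleR [of _ 0 0] by (simp add: mean_def U.prob_space)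
  also have "(1 - \<delta>) * autocorrelation g 0 + (mean u + mean w + mean (w - u))
      \<le> (1 - \<delta>) * (pi * R\<^sup>2 + 1) + M"
    using autocorrelation_0_le [OF loc E] R \<delta> by (intro add_mono mult_left_mono upper) auto
  also have "\<dots> = - pi * R * (\<delta> * R - 14 * \<rho>) - pi * \<rho>\<^sup>2 - \<delta> + 19"
    by (simp add: M_def power2_eq_square algebra_simps)
  also have "\<dots> < 0"
  proof -
    have "3 * 7 * 7 \<le> pi * R * (\<delta> * R - 14 * \<rho>)"
      using pi_gt3 R \<delta>R by (intro mult_mono) auto
    moreover have "pi * \<rho>\<^sup>2 \<ge> 0" by simp
    ultimately show ?thesis using \<delta> by linarith
  qed
  finally show False by simp
qed

theorem theorem9:
  fixes a \<omega> \<phi> m :: real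
    and g :: "real ^ 2 \<Rightarrow> real ^ 2"
    and A B :: "(real ^ 2) set"
  assumes a_pos: "a > 0"
    and omega_pos: "\<omega> > 0"
    and g_def: "g = dilation \<omega> \<circ> rotation \<phi>"
    and m_def: "m = (LEAST v. v \<in> bessel_J0 ` {0..})"
    and bessel_bound:
      "(\<forall>t\<ge>0. bessel_J0 t + bessel_J0 (\<omega> * t) + m > - 1) \<or>
       (\<forall>t\<ge>0. bessel_J0 t + bessel_J0 (\<omega> * t)
          + bessel_J0 (t * sqrt (\<omega>\<^sup>2 - 2 * \<omega> * cos \<phi> + 1)) > - 1)"
    and coloring: "measurable_two_coloring A B"
  shows "\<exists>x y z. monochromatic A B {x, y, z} \<and>
           (\<exists>s \<in> sphere 0 a. y = x + s \<and> z = x + g s)"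
proof -
  define c where "c = sqrt (\<omega>\<^sup>2 - 2 * \<omega> * cos \<phi> + 1)"
  have "\<omega>\<^sup>2 - 2 * \<omega> * cos \<phi> + 1 = (\<omega> - cos \<phi>)\<^sup>2 + (sin \<phi>)\<^sup>2"
    using sin_cos_squared_add [of \<phi>] by (simp add: power2_eq_square algebra_simps)
  then have c2: "c\<^sup>2 = \<omega>\<^sup>2 - 2 * \<omega> * cos \<phi> + 1" and c: "c \<ge> 0"
    by (auto simp: c_def)
  have gt: "bessel_J0 t + bessel_J0 (\<omega> * t) + bessel_J0 (t * c) > - 1" if t: "t \<ge> 0" for t
    using bessel_bound
  proof
    assume "\<forall>t\<ge>0. bessel_J0 t + bessel_J0 (\<omega> * t) + m > - 1"
    moreover have "m \<le> bessel_J0 (t * c)"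
      unfolding m_def using t c by (intro bessel_J0_Least(2)) simp
    ultimately show ?thesis using t by (smt (verit))
  qed (use t in \<open>simp add: c_def\<close>)
  obtain \<delta> where \<delta>: "0 < \<delta>" "\<delta> \<le> 1"
    "\<And>t. t \<ge> 0 \<Longrightarrow> bessel_J0 t + bessel_J0 (\<omega> * t) + bessel_J0 (t * c) \<ge> - 1 + \<delta>"
    using bessel_J0_sum_bounded_away [OF omega_pos c gt] by blast
  \<comment> \<open>Rotations commute with \<open>g\<close>, so every admissible \<open>s\<close> is a rotation of this one.\<close>
  define u :: "real ^ 2" where "u = vector [a, 0]"
  have norm_u: "norm u = a"
    using a_pos by (simp add: u_def norm_vec_def L2_set_def sum_2)
  have g: "g v = \<omega> *\<^sub>R rotation \<phi> v" for v by (simp add: g_def dilation_def)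
  have norm_g: "norm (g u) = \<omega> * a" using omega_pos by (simp add: g norm_rotation norm_u)
  have norm_diff: "norm (g u - u) = c * a"
  proof -
    have "(norm (g u - u))\<^sup>2 = a\<^sup>2 * (\<omega>\<^sup>2 * ((sin \<phi>)\<^sup>2 + (cos \<phi>)\<^sup>2) - 2 * \<omega> * cos \<phi> + 1)"
      unfolding power2_norm_eq_inner
      by (simp add: g u_def rotation_eq inner_vec_def sum_2 power2_eq_square algebra_simps
          del: sin_cos_squared_add sin_cos_squared_add3)
    also have "\<dots> = (c * a)\<^sup>2" by (simp add: c2 power_mult_distrib mult.commute)
    finally show ?thesis using c a_pos by simp
  qed
  have A: "A \<in> sets lebesgue" and B: "B = - A"
    using coloring by (auto simp: measurable_two_coloring_def)
  have "bessel_J0 (t * norm u) + bessel_J0 (t * norm (g u)) + bessel_J0 (t * norm (g u - u)) \<ge> - 1 + \<delta>"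
    if "t \<ge> 0" for t
    using \<delta>(3) [of "t * a"] that a_pos unfolding norm_u norm_g norm_diff by (simp add: mult_ac)
  then obtain x \<theta> where mono: "monochromatic A (- A) {x, x + rotation \<theta> u, x + rotation \<theta> (g u)}"
    using monochromatic_rotated_triple [OF A \<delta>(1,2)] by blast
  have "rotation \<theta> (g u) = g (rotation \<theta> u)"
    by (simp add: g rotation_scaleR rotation_commute [of \<theta>])
  moreover have "rotation \<theta> u \<in> sphere 0 a" by (simp add: norm_rotation norm_u)
  ultimately show ?thesis using mono B by metis
qed

end
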